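(* Let $H$ be a closed subspace of $L^2(G\times Y)$ that is invariant under the translation representation $\rho_{G\times Y}$ of $G$, and suppose that $d_\xi=\dim(\widehat{H}_\xi)=1$ for every $\xi$ in $\Omega$. Let $\psi\in L^\infty(Y)$, and define $\phi\in L^\infty(G\times Y)$ by $\phi(u,v)=\psi(v)$. Then $T_\phi\in\mathcal{V}$ and $T_\phi=\Lambda(\gamma_\psi)$, where $\gamma_\psi\colon\Omega\to\mathbb{C}$ is defined by \[ \gamma_\psi(\xi)=\int_Y\psi(v)\,|q_\xi(v)|^2\,\mathrm{d}\lambda(v). \]
   Context: $G$ is a locally compact abelian group (written additively) with a Haar measure $\nu$, and $Y$ is a measure space with a measure $\lambda$. It is assumed that $G$ is $\sigma$-compact and metrizable, $\lambda$ is $\sigma$-finite, and $L^2(G,\nu)$ and $L^2(Y,\lambda)$ are separable. $G\times Y$ carries the product measure. $\widehat{G}$ is the dual group; $\widehat{\nu}$ is the dual Haar measure, so that the Fourier transform $(F_1f)(\xi)=\int_G\overline{\xi(x)}f(x)\,\mathrm{d}\nu(x)$ extends from $L^1(G)\cap L^2(G)$ to a unitary operator $F\colon L^2(G)\to L^2(\widehat{G},\widehat{\nu})$; $F\otimes I=F\otimes I_{L^2(Y)}\colon L^2(G\times Y)\to L^2(\widehat{G}\times Y)$. $(\rho_{G\times Y}(a)f)(u,v)=f(u-a,v)$; $P$ is the orthogonal projection of $L^2(G\times Y)$ onto $H$ (it commutes with all $\rho_{G\times Y}(a)$). $\rho_H(a)$ is the compression of $\rho_{G\times Y}(a)$ to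 $H$ and $\mathcal{V}=\{S\in\mathcal{B}(H)\colon \rho_H(a)S=S\rho_H(a)\ \forall a\in G\}$. The projection $\widehat{P}=(F\otimes I)P(F\otimes I)^\ast$ decomposes as $\widehat{P}=\int^\oplus_{\widehat{G}}\widehat{P}_\xi\,\mathrm{d}\widehat{\nu}(\xi)$ with respect to $L^2(\widehat{G}\times Y)=\int^\oplus_{\widehat{G}}L^2(Y)\,\mathrm{d}\widehat{\nu}(\xi)$, for a (measurable) family $(\widehat{P}_\xi)_{\xi\in\widehat{G}}$ of orthogonal projections in $L^2(Y)$; such a family is fixed. $\widehat{H}_\xi=\widehat{P}_\xi(L^2(Y))$, $d_\xi=\dim(\widehat{H}_\xi)$, $\Omega=\{\xi\in\widehat{G}\colon d_\xi>0\}$. A family $(q_\xi)_{\xi\in\Omega}$ is fixed such that $\widehat{H}_\xi=\mathbb{C}q_\xi$, $\|q_\xi\|_{L^2(Y)}=1$ for every $\xi\in\Omega$, and $(\xi,v)\mapsto q_\xi(v)$ is measurable on $\Omega\times Y$. $R\colon H\to L^2(\Omega)$ is the unitary operator $(Rf)(\xi)=\int_Y((F\otimes I)f)(\xi,v)\overline{q_\xi(v)}\,\mathrm{d}\lambda(v)$, and $\Lambda\colon L^\infty(\Omega)\to\mathcal{V}$ is $\Lambda(\sigma)=R^\ast M_\sigma R$, where $M_\sigma$ is multiplication by $\sigma$. For $\phi\in L^\infty(G\times Y)$, the Toeplitz operator $T_\phi\colon H\to H$ is $T_\phi f=P(\phi f)$. *)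

theory Defs
  imports "HOL-Analysis.Analysis"
begin

section \<open>Square-integrable functions and operators between spaces of them\<close>

text \<open>
  An element of $L^2(M)$ is represented by a square-integrable function, and equality in $L^2(M)$ is
  equality almost everywhere.  Accordingly, operators are functions on representatives,
  and every equation between elements of $L^2$ is stated up to null sets.
\<close>

definition L2 :: "'a measure \<Rightarrow> ('a \<Rightarrow> complex) set" where
  "L2 M = {f \<in> borel_measurable M. integrable M (\<lambda>x. (cmod (f x))\<^sup>2)}"

definition L2_eq :: "'a measure \<Rightarrow> ('a \<Rightarrow> complex) \<Rightarrow> ('a \<Rightarrow> complex) \<Rightarrow> bool" where
  "L2_eq M f g \<longleftrightarrow> (AE x in M. f x = g x)"

definition L2_inner :: "'a measure \<Rightarrow> ('a \<Rightarrow> complex) \<Rightarrow> ('a \<Rightarrow> complex) \<Rightarrow> complex" where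
  "L2_inner M f g = (\<integral>x. f x * cnj (g x) \<partial>M)"

definition L2_norm :: "'a measure \<Rightarrow> ('a \<Rightarrow> complex) \<Rightarrow> real" where
  "L2_norm M f = sqrt (\<integral>x. (cmod (f x))\<^sup>2 \<partial>M)"

definition Linf :: "'a measure \<Rightarrow> ('a \<Rightarrow> complex) set" where
  "Linf M = {f \<in> borel_measurable M. \<exists>C. AE x in M. cmod (f x) \<le> C}"

definition L2_separable :: "'a measure \<Rightarrow> bool" where
  "L2_separable M \<longleftrightarrow>
     (\<exists>D. countable D \<and> D \<subseteq> L2 M \<and>
        (\<forall>f\<in>L2 M. \<forall>e>0. \<exists>d\<in>D. L2_norm M (\<lambda>x. f x - d x) < e))"

text \<open>
  The last clause is sequential closedness in the seminorm; applied to constant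
  sequences, it also makes the set closed under modification on null sets.
\<close>

definition L2_closed_subspace :: "'a measure \<Rightarrow> ('a \<Rightarrow> complex) set \<Rightarrow> bool" where
  "L2_closed_subspace M H \<longleftrightarrow>
     H \<subseteq> L2 M \<and> (\<lambda>x. 0) \<in> H \<and>
     (\<forall>f\<in>H. \<forall>g\<in>H. (\<lambda>x. f x + g x) \<in> H) \<and>
     (\<forall>c. \<forall>f\<in>H. (\<lambda>x. c * f x) \<in> H) \<and>
     (\<forall>s f. (\<forall>n::nat. s n \<in> H) \<longrightarrow> f \<in> L2 M \<longrightarrow>
        (\<lambda>n. L2_norm M (\<lambda>x. s n x - f x)) \<longlonglongrightarrow> 0 \<longrightarrow> f \<in> H)"

text \<open>
  Compatibility with almost everywhere equality need not be required separately below: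
  it follows from additivity and boundedness.
\<close>

definition L2_bounded_op ::
  "'a measure \<Rightarrow> ('a \<Rightarrow> complex) set \<Rightarrow> 'b measure \<Rightarrow> ('b \<Rightarrow> complex) set \<Rightarrow>
   (('a \<Rightarrow> complex) \<Rightarrow> ('b \<Rightarrow> complex)) \<Rightarrow> bool" where
  "L2_bounded_op M H N K S \<longleftrightarrow>
     (\<forall>f\<in>H. S f \<in> K) \<and>
     (\<forall>f\<in>H. \<forall>g\<in>H. L2_eq N (S (\<lambda>x. f x + g x)) (\<lambda>y. S f y + S g y)) \<and>
     (\<forall>c. \<forall>f\<in>H. L2_eq N (S (\<lambda>x. c * f x)) (\<lambda>y. c * S f y)) \<and>
     (\<exists>C. \<forall>f\<in>H. L2_norm N (S f) \<le> C * L2_norm M f)"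

definition L2_unitary ::
  "'a measure \<Rightarrow> ('a \<Rightarrow> complex) set \<Rightarrow> 'b measure \<Rightarrow> ('b \<Rightarrow> complex) set \<Rightarrow>
   (('a \<Rightarrow> complex) \<Rightarrow> ('b \<Rightarrow> complex)) \<Rightarrow> bool" where
  "L2_unitary M H N K S \<longleftrightarrow>
     L2_bounded_op M H N K S \<and>
     (\<forall>f\<in>H. L2_norm N (S f) = L2_norm M f) \<and>
     (\<forall>g\<in>K. \<exists>f\<in>H. L2_eq N (S f) g)"

text \<open>
  The adjoint of a bounded operator \<open>S\<close> from \<open>H\<close> into $L^2(N)$, where \<open>H\<close> is a closed
  subspace of $L^2(M)$.  The chosen element is unique up to null sets.
\<close>

definition L2_adjoint ::
  "'a measure \<Rightarrow> ('a \<Rightarrow> complex) set \<Rightarrow> 'b measure \<Rightarrow>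
   (('a \<Rightarrow> complex) \<Rightarrow> ('b \<Rightarrow> complex)) \<Rightarrow> (('b \<Rightarrow> complex) \<Rightarrow> ('a \<Rightarrow> complex))" where
  "L2_adjoint M H N S g =
     (SOME h. h \<in> H \<and> (\<forall>f\<in>H. L2_inner N (S f) g = L2_inner M f h))"

definition is_L2_projection_onto ::
  "'a measure \<Rightarrow> ('a \<Rightarrow> complex) set \<Rightarrow> (('a \<Rightarrow> complex) \<Rightarrow> ('a \<Rightarrow> complex)) \<Rightarrow> bool" where
  "is_L2_projection_onto M H P \<longleftrightarrow>
     (\<forall>f\<in>L2 M. P f \<in> H \<and> (\<forall>h\<in>H. L2_inner M (\<lambda>x. f x - P f x) h = 0))"

definition is_L2_projection ::
  "'a measure \<Rightarrow> (('a \<Rightarrow> complex) \<Rightarrow> ('a \<Rightarrow> complex)) \<Rightarrow> bool" where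
  "is_L2_projection M P \<longleftrightarrow> (\<exists>K. L2_closed_subspace M K \<and> is_L2_projection_onto M K P)"

definition L2_range ::
  "'a measure \<Rightarrow> (('a \<Rightarrow> complex) \<Rightarrow> ('a \<Rightarrow> complex)) \<Rightarrow> ('a \<Rightarrow> complex) set" where
  "L2_range M P = {g \<in> L2 M. \<exists>f\<in>L2 M. L2_eq M g (P f)}"

definition L2_span1 :: "'a measure \<Rightarrow> ('a \<Rightarrow> complex) \<Rightarrow> ('a \<Rightarrow> complex) set" where
  "L2_span1 M q = {g \<in> L2 M. \<exists>c. L2_eq M g (\<lambda>x. c * q x)}"

text \<open>
  Hilbert space dimension, with all infinite dimensions identified.  Two functions that
  are equal almost everywhere cannot both belong to an orthonormal set, so cardinalities
  of sets of representatives are the right ones.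
\<close>

definition L2_dim :: "'a measure \<Rightarrow> ('a \<Rightarrow> complex) set \<Rightarrow> enat" where
  "L2_dim M K =
     Sup {enat (card B) | B. finite B \<and> B \<subseteq> K \<and>
       (\<forall>f\<in>B. \<forall>g\<in>B. L2_inner M f g = (if f = g then 1 else 0))}"


section \<open>Haar measures, the dual group and the Fourier transform\<close>

text \<open>
  A nonzero invariant Radon measure on the Borel sets of a locally compact group with
  underlying space \<open>topspace T\<close> and operation \<open>m\<close>.
\<close>

definition is_haar_measure :: "'a topology \<Rightarrow> ('a \<Rightarrow> 'a \<Rightarrow> 'a) \<Rightarrow> 'a measure \<Rightarrow> bool" where
  "is_haar_measure T m M \<longleftrightarrow>
     space M = topspace T \<and>
     sets M = sigma_sets (topspace T) {U. openin T U} \<and>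
     emeasure M (topspace T) \<noteq> 0 \<and>
     (\<forall>K. compactin T K \<longrightarrow> emeasure M K < \<infinity>) \<and>
     (\<forall>a\<in>topspace T. \<forall>A\<in>sets M. emeasure M (m a ` A) = emeasure M A) \<and>
     (\<forall>A\<in>sets M. emeasure M A = (INF U\<in>{U. openin T U \<and> A \<subseteq> U}. emeasure M U)) \<and>
     (\<forall>U. openin T U \<longrightarrow> emeasure M U = (SUP K\<in>{K. compactin T K \<and> K \<subseteq> U}. emeasure M K))"

definition sigma_compact_space :: "'a topology \<Rightarrow> bool" where
  "sigma_compact_space T \<longleftrightarrow>
     (\<exists>K :: nat \<Rightarrow> 'a set. (\<forall>n. compactin T (K n)) \<and> (\<Union>n. K n) = topspace T)"

definition dual_group :: "('g::topological_ab_group_add \<Rightarrow> complex) set" where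
  "dual_group =
     {\<xi>. continuous_on UNIV \<xi> \<and> (\<forall>x. cmod (\<xi> x) = 1) \<and> (\<forall>x y. \<xi> (x + y) = \<xi> x * \<xi> y)}"

text \<open>The compact-open topology on the dual group.\<close>

definition dual_topology :: "('g::topological_ab_group_add \<Rightarrow> complex) topology" where
  "dual_topology =
     topology_generated_by {{\<xi> \<in> dual_group. \<xi> ` K \<subseteq> U} | K U. compact K \<and> open U}"

definition fourier_L1 ::
  "'g measure \<Rightarrow> ('g \<Rightarrow> complex) \<Rightarrow> ('g \<Rightarrow> complex) \<Rightarrow> complex" where
  "fourier_L1 \<nu> f \<xi> = (\<integral>x. cnj (\<xi> x) * f x \<partial>\<nu>)"

text \<open>
  Haar measures on the dual group are unique up to a positive factor; the dual one is
  singled out by the Plancherel normalisation.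
\<close>

definition is_dual_haar_measure ::
  "'g::topological_ab_group_add measure \<Rightarrow> ('g \<Rightarrow> complex) measure \<Rightarrow> bool" where
  "is_dual_haar_measure \<nu> \<nu>' \<longleftrightarrow>
     is_haar_measure dual_topology (\<lambda>\<xi> \<eta> x. \<xi> x * \<eta> x) \<nu>' \<and>
     (\<forall>f\<in>L2 \<nu>. integrable \<nu> f \<longrightarrow>
        fourier_L1 \<nu> f \<in> L2 \<nu>' \<and> L2_norm \<nu>' (fourier_L1 \<nu> f) = L2_norm \<nu> f)"

definition is_L2_fourier ::
  "'g measure \<Rightarrow> ('g \<Rightarrow> complex) measure \<Rightarrow>
   (('g \<Rightarrow> complex) \<Rightarrow> (('g \<Rightarrow> complex) \<Rightarrow> complex)) \<Rightarrow> bool" where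
  "is_L2_fourier \<nu> \<nu>' F \<longleftrightarrow>
     L2_unitary \<nu> (L2 \<nu>) \<nu>' (L2 \<nu>') F \<and>
     (\<forall>f\<in>L2 \<nu>. integrable \<nu> f \<longrightarrow> L2_eq \<nu>' (F f) (fourier_L1 \<nu> f))"

text \<open>
  \<open>FI\<close> is the operator $F \otimes I$, that is, the bounded operator on $L^2$ of the product
  determined by its values on elementary tensors.
\<close>

definition is_tensor_id ::
  "'a measure \<Rightarrow> 'b measure \<Rightarrow> 'y measure \<Rightarrow> (('a \<Rightarrow> complex) \<Rightarrow> ('b \<Rightarrow> complex)) \<Rightarrow>
   (('a \<times> 'y \<Rightarrow> complex) \<Rightarrow> ('b \<times> 'y \<Rightarrow> complex)) \<Rightarrow> bool" where
  "is_tensor_id M N L F FI \<longleftrightarrow>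
     L2_bounded_op (M \<Otimes>\<^sub>M L) (L2 (M \<Otimes>\<^sub>M L)) (N \<Otimes>\<^sub>M L) (L2 (N \<Otimes>\<^sub>M L)) FI \<and>
     (\<forall>f\<in>L2 M. \<forall>g\<in>L2 L.
        L2_eq (N \<Otimes>\<^sub>M L) (FI (\<lambda>(x, v). f x * g v)) (\<lambda>(y, v). F f y * g v))"


section \<open>Translation-invariant spaces, Toeplitz operators and the spectral map\<close>

definition translation :: "'g::group_add \<Rightarrow> ('g \<times> 'y \<Rightarrow> complex) \<Rightarrow> ('g \<times> 'y \<Rightarrow> complex)" where
  "translation a f = (\<lambda>(u, v). f (u - a, v))"

definition translation_commutant ::
  "('g::group_add \<times> 'y) measure \<Rightarrow> ('g \<times> 'y \<Rightarrow> complex) set \<Rightarrow>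
   (('g \<times> 'y \<Rightarrow> complex) \<Rightarrow> ('g \<times> 'y \<Rightarrow> complex)) \<Rightarrow>
   (('g \<times> 'y \<Rightarrow> complex) \<Rightarrow> ('g \<times> 'y \<Rightarrow> complex)) set" where
  "translation_commutant M H P =
     {S. L2_bounded_op M H M H S \<and>
         (\<forall>a. \<forall>f\<in>H. L2_eq M (P (translation a (S f))) (S (P (translation a f))))}"

definition toeplitz ::
  "(('a \<Rightarrow> complex) \<Rightarrow> ('a \<Rightarrow> complex)) \<Rightarrow> ('a \<Rightarrow> complex) \<Rightarrow> ('a \<Rightarrow> complex) \<Rightarrow> ('a \<Rightarrow> complex)" where
  "toeplitz P \<phi> f = P (\<lambda>z. \<phi> z * f z)"

text \<open>
  \<open>A\<close> is the direct integral over \<open>N\<close> of the measurable family \<open>Q\<close> of operators in $L^2(L)$,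
  where $L^2(N \times L)$ is identified with the direct integral of copies of $L^2(L)$.
\<close>

definition is_direct_integral ::
  "'b measure \<Rightarrow> 'y measure \<Rightarrow> (('b \<times> 'y \<Rightarrow> complex) \<Rightarrow> ('b \<times> 'y \<Rightarrow> complex)) \<Rightarrow>
   ('b \<Rightarrow> ('y \<Rightarrow> complex) \<Rightarrow> ('y \<Rightarrow> complex)) \<Rightarrow> bool" where
  "is_direct_integral N L A Q \<longleftrightarrow>
     (\<forall>g\<in>L2 L. \<forall>h\<in>L2 L. (\<lambda>\<xi>. L2_inner L (Q \<xi> g) h) \<in> borel_measurable N) \<and>
     (\<forall>f\<in>L2 (N \<Otimes>\<^sub>M L). AE \<xi> in N.
        L2_eq L (\<lambda>v. A f (\<xi>, v)) (Q \<xi> (\<lambda>v. f (\<xi>, v))))"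

definition conjugate_projection ::
  "('a \<times> 'y) measure \<Rightarrow> ('b \<times> 'y) measure \<Rightarrow>
   (('a \<times> 'y \<Rightarrow> complex) \<Rightarrow> ('b \<times> 'y \<Rightarrow> complex)) \<Rightarrow>
   (('a \<times> 'y \<Rightarrow> complex) \<Rightarrow> ('a \<times> 'y \<Rightarrow> complex)) \<Rightarrow>
   (('b \<times> 'y \<Rightarrow> complex) \<Rightarrow> ('b \<times> 'y \<Rightarrow> complex))" where
  "conjugate_projection M N FI P g = FI (P (L2_adjoint M (L2 M) N FI g))"

definition fiber_dim ::
  "'y measure \<Rightarrow> ('b \<Rightarrow> ('y \<Rightarrow> complex) \<Rightarrow> ('y \<Rightarrow> complex)) \<Rightarrow> 'b \<Rightarrow> enat" where
  "fiber_dim L Q \<xi> = L2_dim L (L2_range L (Q \<xi>))"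

definition Omega ::
  "'y measure \<Rightarrow> (('g::topological_ab_group_add \<Rightarrow> complex) \<Rightarrow> ('y \<Rightarrow> complex) \<Rightarrow> ('y \<Rightarrow> complex)) \<Rightarrow>
   ('g \<Rightarrow> complex) set" where
  "Omega L Q = {\<xi> \<in> dual_group. fiber_dim L Q \<xi> > 0}"

definition R_op ::
  "'y measure \<Rightarrow> ('x \<Rightarrow> ('b \<times> 'y \<Rightarrow> complex)) \<Rightarrow> ('b \<Rightarrow> 'y \<Rightarrow> complex) \<Rightarrow> 'x \<Rightarrow> 'b \<Rightarrow> complex" where
  "R_op L FI q f \<xi> = (\<integral>v. FI f (\<xi>, v) * cnj (q \<xi> v) \<partial>L)"

text \<open>
  $R^* M_\sigma R$ for an operator \<open>R\<close> from the subspace \<open>H\<close> of $L^2(M)$ into $L^2(N)$.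
\<close>

definition Lambda_op ::
  "'a measure \<Rightarrow> ('a \<Rightarrow> complex) set \<Rightarrow> 'b measure \<Rightarrow>
   (('a \<Rightarrow> complex) \<Rightarrow> ('b \<Rightarrow> complex)) \<Rightarrow> ('b \<Rightarrow> complex) \<Rightarrow> ('a \<Rightarrow> complex) \<Rightarrow> ('a \<Rightarrow> complex)" where
  "Lambda_op M H N R \<sigma> f = L2_adjoint M H N R (\<lambda>\<xi>. \<sigma> \<xi> * R f \<xi>)"

definition gamma_fun ::
  "'y measure \<Rightarrow> ('b \<Rightarrow> 'y \<Rightarrow> complex) \<Rightarrow> ('y \<Rightarrow> complex) \<Rightarrow> 'b \<Rightarrow> complex" where
  "gamma_fun L q \<psi> \<xi> = (\<integral>v. \<psi> v * of_real ((cmod (q \<xi> v))\<^sup>2) \<partial>L)"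

end

theory Submission
  imports Defs
begin

text \<open>
  Multiplication by $\phi(u,v)=\psi(v)$ commutes with $F \otimes I$, and for $f \in H$ almost every
  fibre $((F \otimes I) f)(\xi, \cdot)$ lies in the range of $\widehat{P}_\xi$, hence equals
  $(Rf)(\xi)\, q_\xi$ on $\Omega$ and vanishes off $\Omega$.  As $F \otimes I$ is isometric,
  Fubini gives $\langle k, \phi f\rangle = \langle Rk, \gamma_\psi Rf\rangle$ for
  $f, k \in H$, which characterises $R^* M_{\gamma_\psi} R f$ as the projection of $\phi f$
  to \<open>H\<close>.  Both properties of $F \otimes I$ are checked on elementary tensors and extended
  by density.
\<close>

section \<open>Square-integrable functions\<close>

text \<open>Operators act on representatives, so the value of F tensor I at a single fibre carries
  no information: identities are proved through inner products and read fibrewise only afterwards,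
  for almost every \<xi>. Density of elementary tensors is used in L2 of
  \<open>\<nu> \<Otimes>\<^sub>M lam\<close>, where \<nu> is sigma-finite because G is a countable
  union of compact sets; every relation involving F tensor I is therefore extended over a closed
  subspace of that space. The adjoint inside \<open>Lambda_op\<close> is a choice; it is pinned down
  by exhibiting the Toeplitz value as an admissible witness, which inner products with H determine
  up to null sets. A separate obstacle is that \<open>Omega\<close> is defined by a dimension. Its
  measurability comes from the scalar functions <Phat_\<xi> d, d> with d in a countable dense subset
  of L2(Y): the dimension is positive exactly when one of them is nonzero at \<xi>.\<close>

lemma borel_measurable_cnj [measurable (raw)]:
  "f \<in> borel_measurable M \<Longrightarrow> (\<lambda>x. cnj (f x)) \<in> borel_measurable M"
  by (rule borel_measurable_continuous_on[of cnj]) (intro continuous_intros)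

lemma L2_measurable: "f \<in> L2 M \<Longrightarrow> f \<in> borel_measurable M"
  and L2_integrable_power: "f \<in> L2 M \<Longrightarrow> integrable M (\<lambda>x. (cmod (f x))\<^sup>2)"
  by (auto simp: L2_def)

lemma L2I_bound:
  assumes [measurable]: "f \<in> borel_measurable M" and "integrable M w"
    and "AE x in M. (cmod (f x))\<^sup>2 \<le> w x"
  shows "f \<in> L2 M"
proof -
  have "integrable M (\<lambda>x. (cmod (f x))\<^sup>2)"
    using assms(3) by (intro Bochner_Integration.integrable_bound[OF assms(2)]) (auto elim: eventually_mono)
  then show ?thesis
    by (simp add: L2_def)
qed

lemma L2_cong_AE:
  assumes "f \<in> L2 M" "g \<in> borel_measurable M" "AE x in M. g x = f x"
  shows "g \<in> L2 M"
  using assms by (intro L2I_bound[OF _ L2_integrable_power[OF assms(1)]]) (auto elim: eventually_mono)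

lemma L2_zero: "(\<lambda>x. 0) \<in> L2 M"
  by (simp add: L2_def)

lemma L2_add:
  assumes "f \<in> L2 M" "g \<in> L2 M"
  shows "(\<lambda>x. f x + g x) \<in> L2 M"
proof (rule L2I_bound)
  show "(\<lambda>x. f x + g x) \<in> borel_measurable M"
    using assms[THEN L2_measurable] by simp
  show "integrable M (\<lambda>x. 2 * (cmod (f x))\<^sup>2 + 2 * (cmod (g x))\<^sup>2)"
    using assms[THEN L2_integrable_power] by simp
  have "(cmod (a + b))\<^sup>2 \<le> 2 * (cmod a)\<^sup>2 + 2 * (cmod b)\<^sup>2" for a b
  proof -
    have "(cmod (a + b))\<^sup>2 \<le> (cmod a + cmod b)\<^sup>2"
      by (simp add: norm_triangle_ineq power_mono)
    also have "\<dots> \<le> 2 * (cmod a)\<^sup>2 + 2 * (cmod b)\<^sup>2"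
      using zero_le_power2[of "cmod a - cmod b"] by (simp add: power2_eq_square algebra_simps)
    finally show ?thesis .
  qed
  then show "AE x in M. (cmod (f x + g x))\<^sup>2 \<le> 2 * (cmod (f x))\<^sup>2 + 2 * (cmod (g x))\<^sup>2"
    by simp
qed

lemma L2_scale: "f \<in> L2 M \<Longrightarrow> (\<lambda>x. c * f x) \<in> L2 M"
  by (auto simp: L2_def norm_mult power_mult_distrib)

lemma L2_diff: "f \<in> L2 M \<Longrightarrow> g \<in> L2 M \<Longrightarrow> (\<lambda>x. f x - g x) \<in> L2 M"
  using L2_add[of f M "\<lambda>x. - 1 * g x"] L2_scale[of g M "- 1"] by simp

lemma LinfE:
  assumes "\<phi> \<in> Linf M"
  obtains C where "0 \<le> C" "AE x in M. cmod (\<phi> x) \<le> C"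
proof -
  obtain C where "AE x in M. cmod (\<phi> x) \<le> C"
    using assms by (auto simp: Linf_def)
  \<comment> \<open>If the measure is zero, \<open>C\<close> may be negative; the later estimates
    square it or multiply norms by it.\<close>
  then have "AE x in M. cmod (\<phi> x) \<le> max 0 C"
    by (auto elim: eventually_mono)
  then show thesis
    by (intro that[of "max 0 C"]) auto
qed

lemma L2_mult_Linf:
  assumes "\<phi> \<in> Linf M" "f \<in> L2 M"
  shows "(\<lambda>x. \<phi> x * f x) \<in> L2 M"
proof -
  obtain C where C: "0 \<le> C" "AE x in M. cmod (\<phi> x) \<le> C"
    using assms(1) by (rule LinfE)
  show ?thesis
  proof (rule L2I_bound)
    show "(\<lambda>x. \<phi> x * f x) \<in> borel_measurable M"
      using assms by (auto simp: Linf_def L2_def)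
    show "integrable M (\<lambda>x. C\<^sup>2 * (cmod (f x))\<^sup>2)"
      using L2_integrable_power[OF assms(2)] by simp
    show "AE x in M. (cmod (\<phi> x * f x))\<^sup>2 \<le> C\<^sup>2 * (cmod (f x))\<^sup>2"
      using C(2) by eventually_elim
        (auto simp: norm_mult power_mult_distrib intro!: mult_right_mono power_mono)
  qed
qed

lemma integrable_L2_inner:
  assumes "f \<in> L2 M" "g \<in> L2 M"
  shows "integrable M (\<lambda>x. f x * cnj (g x))"
proof (rule Bochner_Integration.integrable_bound)
  have [measurable]: "f \<in> borel_measurable M" "g \<in> borel_measurable M"
    using assms by (auto intro: L2_measurable)
  show "(\<lambda>x. f x * cnj (g x)) \<in> borel_measurable M"
    by measurable
  show "integrable M (\<lambda>x. (cmod (f x))\<^sup>2 + (cmod (g x))\<^sup>2)"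
    using assms[THEN L2_integrable_power] by simp
  have "a * b \<le> a\<^sup>2 + b\<^sup>2" if "0 \<le> a" "0 \<le> b" for a b :: real
    using sum_squares_bound[of a b] mult_nonneg_nonneg[OF that] by linarith
  then show "AE x in M. norm (f x * cnj (g x)) \<le> norm ((cmod (f x))\<^sup>2 + (cmod (g x))\<^sup>2)"
    by (simp add: norm_mult)
qed

lemma L2_inner_add_left:
  assumes "f \<in> L2 M" "g \<in> L2 M" "h \<in> L2 M"
  shows "L2_inner M (\<lambda>x. f x + g x) h = L2_inner M f h + L2_inner M g h"
  using assms by (simp add: L2_inner_def distrib_right integrable_L2_inner)

lemma L2_inner_diff_left:
  assumes "f \<in> L2 M" "g \<in> L2 M" "h \<in> L2 M"
  shows "L2_inner M (\<lambda>x. f x - g x) h = L2_inner M f h - L2_inner M g h"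
  using assms by (simp add: L2_inner_def left_diff_distrib integrable_L2_inner)

lemma L2_inner_scale_left: "L2_inner M (\<lambda>x. c * f x) h = c * L2_inner M f h"
  by (simp add: L2_inner_def mult.assoc)

lemma L2_inner_commute: "L2_inner M g f = cnj (L2_inner M f g)"
  unfolding L2_inner_def Bochner_Integration.integral_cnj[symmetric] by (simp add: mult.commute)

lemma L2_inner_add_right:
  assumes "f \<in> L2 M" "g \<in> L2 M" "h \<in> L2 M"
  shows "L2_inner M h (\<lambda>x. f x + g x) = L2_inner M h f + L2_inner M h g"
  using L2_inner_add_left[OF assms] by (metis L2_inner_commute complex_cnj_add)

lemma L2_inner_scale_right: "L2_inner M h (\<lambda>x. c * f x) = cnj c * L2_inner M h f"
  using L2_inner_scale_left by (metis L2_inner_commute complex_cnj_mult)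

lemma L2_inner_cong_AE:
  assumes "f \<in> L2 M" "f' \<in> L2 M" "g \<in> L2 M" "g' \<in> L2 M"
    and "AE x in M. f x = f' x" "AE x in M. g x = g' x"
  shows "L2_inner M f g = L2_inner M f' g'"
  unfolding L2_inner_def
proof (rule integral_cong_AE)
  show "(\<lambda>x. f x * cnj (g x)) \<in> borel_measurable M" "(\<lambda>x. f' x * cnj (g' x)) \<in> borel_measurable M"
    using assms(1-4) by (auto intro!: borel_measurable_integrable integrable_L2_inner)
  show "AE x in M. f x * cnj (g x) = f' x * cnj (g' x)"
    using assms(5,6) by eventually_elim simp
qed

lemma L2_norm_nonneg: "0 \<le> L2_norm M f"
  by (simp add: L2_norm_def)

lemma L2_norm_power2: "(L2_norm M f)\<^sup>2 = (\<integral>x. (cmod (f x))\<^sup>2 \<partial>M)"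
  by (simp add: L2_norm_def)

lemma L2_inner_self: "L2_inner M f f = of_real ((L2_norm M f)\<^sup>2)"
proof -
  have "z * cnj z = complex_of_real ((cmod z)\<^sup>2)" for z
    by (rule complex_norm_square[symmetric])
  then show ?thesis
    unfolding L2_norm_power2 L2_inner_def by (simp only: integral_complex_of_real)
qed

lemma L2_norm_cong_AE:
  assumes "f \<in> L2 M" "g \<in> L2 M" "AE x in M. f x = g x"
  shows "L2_norm M f = L2_norm M g"
  using L2_inner_cong_AE[OF assms(1,2,1,2,3,3)] L2_norm_nonneg[of M f] L2_norm_nonneg[of M g]
  by (simp add: L2_inner_self flip: of_real_power)

lemma L2_norm_eq_0_iff:
  assumes "f \<in> L2 M"
  shows "L2_norm M f = 0 \<longleftrightarrow> (AE x in M. f x = 0)"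
  using integral_nonneg_eq_0_iff_AE[OF L2_integrable_power[OF assms]] by (simp add: L2_norm_def)

lemma L2_norm_scale: "L2_norm M (\<lambda>x. c * f x) = cmod c * L2_norm M f"
  by (simp add: L2_norm_def norm_mult power_mult_distrib real_sqrt_mult)

lemma L2_norm_minus_commute: "L2_norm M (\<lambda>x. f x - g x) = L2_norm M (\<lambda>x. g x - f x)"
  by (simp add: L2_norm_def norm_minus_commute)

section \<open>Inner product geometry: expansion of squares, Cauchy-Schwarz, triangle
  inequality\<close>

lemma L2_norm_add_power2:
  assumes "f \<in> L2 M" "g \<in> L2 M"
  shows "(L2_norm M (\<lambda>x. f x + g x))\<^sup>2 = (L2_norm M f)\<^sup>2 + 2 * Re (L2_inner M f g) + (L2_norm M g)\<^sup>2"
proof -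
  have "L2_inner M (\<lambda>x. f x + g x) (\<lambda>x. f x + g x) =
      L2_inner M f f + (L2_inner M f g + cnj (L2_inner M f g)) + L2_inner M g g"
    using assms L2_add[OF assms] L2_inner_commute[of M g f]
    by (simp add: L2_inner_add_left L2_inner_add_right)
  then have "Re (L2_inner M (\<lambda>x. f x + g x) (\<lambda>x. f x + g x)) =
      Re (L2_inner M f f) + 2 * Re (L2_inner M f g) + Re (L2_inner M g g)"
    by simp
  then show ?thesis
    by (simp add: L2_inner_self del: of_real_power)
qed

text \<open>Write z for the inner product of f and g. The square of the norm of f - t z g is
  nonnegative for every real t; the factor z turns the cross term into the real number -2 t |z|^2,
  leaving a quadratic polynomial in t.\<close>

lemma L2_Cauchy_Schwarz:
  assumes "f \<in> L2 M" "g \<in> L2 M"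
  shows "cmod (L2_inner M f g) \<le> L2_norm M f * L2_norm M g"
proof -
  define a where "a = L2_norm M f"
  define b where "b = L2_norm M g"
  define z where "z = L2_inner M f g"
  have ab: "0 \<le> a" "0 \<le> b"
    by (auto simp: a_def b_def L2_norm_nonneg)
  have pos: "0 \<le> a\<^sup>2 - 2 * t * (cmod z)\<^sup>2 + t\<^sup>2 * (cmod z)\<^sup>2 * b\<^sup>2" for t :: real
  proof -
    let ?c = "- (of_real t * z)"
    have "0 \<le> (L2_norm M (\<lambda>x. f x + ?c * g x))\<^sup>2"
      by simp
    also have "\<dots> = a\<^sup>2 + 2 * Re (cnj ?c * z) + (cmod ?c * b)\<^sup>2"
      using L2_norm_add_power2[OF assms(1) L2_scale[OF assms(2)], of ?c]
      by (simp only: L2_inner_scale_right L2_norm_scale a_def b_def z_def)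
    also have "Re (cnj ?c * z) = - t * (cmod z)\<^sup>2"
      by (simp add: cmod_power2) (simp add: power2_eq_square algebra_simps)
    finally show ?thesis
      by (simp add: norm_mult power_mult_distrib algebra_simps)
  qed
  have "cmod z \<le> a * b"
  proof (cases "b = 0")
    case True
    have "z = 0"
    proof (rule ccontr)
      assume z: "z \<noteq> 0"
      \<comment> \<open>With b = 0 the polynomial is affine in t, and this t is large enough to make
        it negative: the value is a^2 - 2 (a^2 + 1).\<close>
      have "0 \<le> a\<^sup>2 - 2 * ((a\<^sup>2 + 1) / (cmod z)\<^sup>2) * (cmod z)\<^sup>2"
        using pos[of "(a\<^sup>2 + 1) / (cmod z)\<^sup>2"] True by simp
      also have "\<dots> = - a\<^sup>2 - 2"
        using z by simp
      finally show False
        using zero_le_power2[of a] by linarith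
    qed
    then show ?thesis using ab by simp
  next
    case False
    \<comment> \<open>The minimiser of the quadratic is t = 1 / b^2.\<close>
    have "2 * (1 / b\<^sup>2) * (cmod z)\<^sup>2 - (1 / b\<^sup>2)\<^sup>2 * (cmod z)\<^sup>2 * b\<^sup>2 = (cmod z)\<^sup>2 / b\<^sup>2"
      using False by (simp add: power2_eq_square divide_simps)
    then have "(cmod z)\<^sup>2 / b\<^sup>2 \<le> a\<^sup>2"
      using pos[of "1 / b\<^sup>2"] by linarith
    then have "(cmod z)\<^sup>2 \<le> (a * b)\<^sup>2"
      using False by (simp add: power_mult_distrib divide_le_eq)
    then show ?thesis
      using ab by (simp add: power2_le_iff_abs_le)
  qed
  then show ?thesis
    by (simp add: a_def b_def z_def)
qed

lemma L2_norm_triangle: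
  assumes "f \<in> L2 M" "g \<in> L2 M"
  shows "L2_norm M (\<lambda>x. f x + g x) \<le> L2_norm M f + L2_norm M g"
proof (rule power2_le_imp_le)
  have "Re (L2_inner M f g) \<le> L2_norm M f * L2_norm M g"
    using L2_Cauchy_Schwarz[OF assms] complex_Re_le_cmod order_trans by blast
  then show "(L2_norm M (\<lambda>x. f x + g x))\<^sup>2 \<le> (L2_norm M f + L2_norm M g)\<^sup>2"
    unfolding L2_norm_add_power2[OF assms] by (simp add: power2_sum)
qed (simp add: L2_norm_nonneg)

lemma L2_norm_mult_Linf_le:
  assumes "\<phi> \<in> borel_measurable M" "0 \<le> C" "AE x in M. cmod (\<phi> x) \<le> C" "f \<in> L2 M"
  shows "L2_norm M (\<lambda>x. \<phi> x * f x) \<le> C * L2_norm M f"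
proof (rule power2_le_imp_le)
  have "(\<lambda>x. \<phi> x * f x) \<in> L2 M"
    using assms by (intro L2_mult_Linf) (auto simp: Linf_def)
  then have "(\<integral>x. (cmod (\<phi> x * f x))\<^sup>2 \<partial>M) \<le> (\<integral>x. C\<^sup>2 * (cmod (f x))\<^sup>2 \<partial>M)"
  proof (intro integral_mono_AE)
    show "AE x in M. (cmod (\<phi> x * f x))\<^sup>2 \<le> C\<^sup>2 * (cmod (f x))\<^sup>2"
      using assms(3) by eventually_elim
        (auto simp: norm_mult power_mult_distrib intro!: mult_right_mono power_mono)
  qed (use assms(4) in \<open>auto intro: L2_integrable_power\<close>)
  then show "(L2_norm M (\<lambda>x. \<phi> x * f x))\<^sup>2 \<le> (C * L2_norm M f)\<^sup>2"
    by (simp add: L2_norm_power2 power_mult_distrib)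
qed (simp add: L2_norm_nonneg assms)

section \<open>Norm limits in L2\<close>

lemma L2_inner_tendsto_left:
  assumes "\<And>n. s n \<in> L2 M" "f \<in> L2 M" "g \<in> L2 M"
    and lim: "(\<lambda>n. L2_norm M (\<lambda>x. s n x - f x)) \<longlonglongrightarrow> 0"
  shows "(\<lambda>n. L2_inner M (s n) g) \<longlonglongrightarrow> L2_inner M f g"
proof (rule LIM_zero_cancel, rule Lim_null_comparison)
  show "\<forall>\<^sub>F n in sequentially. norm (L2_inner M (s n) g - L2_inner M f g)
      \<le> L2_norm M (\<lambda>x. s n x - f x) * L2_norm M g"
    using assms L2_Cauchy_Schwarz[OF L2_diff[OF assms(1,2)] assms(3)]
    by (simp add: L2_inner_diff_left)
  show "(\<lambda>n. L2_norm M (\<lambda>x. s n x - f x) * L2_norm M g) \<longlonglongrightarrow> 0"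
    using tendsto_mult_left_zero[OF lim] .
qed

text \<open>Two limits of one sequence are at distance zero by the triangle inequality, and distance
  zero is equality almost everywhere. This is how continuity arguments return to statements about
  representatives.\<close>

lemma L2_limit_unique:
  assumes "\<And>n. s n \<in> L2 M" "f \<in> L2 M" "g \<in> L2 M"
    and "(\<lambda>n. L2_norm M (\<lambda>x. s n x - f x)) \<longlonglongrightarrow> 0"
    and "(\<lambda>n. L2_norm M (\<lambda>x. s n x - g x)) \<longlonglongrightarrow> 0"
  shows "AE x in M. f x = g x"
proof -
  have "L2_norm M (\<lambda>x. f x - g x) \<le> L2_norm M (\<lambda>x. s n x - f x) + L2_norm M (\<lambda>x. s n x - g x)" for n
    using L2_norm_triangle[of "\<lambda>x. f x - s n x" M "\<lambda>x. s n x - g x"] assms(1-3)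
    by (simp add: L2_diff L2_norm_minus_commute[of M f])
  then have "L2_norm M (\<lambda>x. f x - g x) \<le> 0"
    using tendsto_add[OF assms(4,5)] by (intro LIMSEQ_le_const) auto
  then have "L2_norm M (\<lambda>x. f x - g x) = 0"
    using L2_norm_nonneg[of M "\<lambda>x. f x - g x"] by linarith
  then show ?thesis
    using assms(2,3) by (simp add: L2_norm_eq_0_iff L2_diff)
qed

text \<open>Scalar dominated convergence for |s n - f|^2. The majorant bounds the difference because
  its square is then the integrable function required.\<close>

lemma L2_dominated_convergence:
  assumes "f \<in> borel_measurable M" "\<And>n. s n \<in> borel_measurable M" "g \<in> L2 M"
    and lim: "\<And>x. x \<in> space M \<Longrightarrow> (\<lambda>n. s n x) \<longlonglongrightarrow> f x"
    and bound: "\<And>n x. x \<in> space M \<Longrightarrow> cmod (s n x - f x) \<le> cmod (g x)"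
  shows "(\<lambda>n. L2_norm M (\<lambda>x. s n x - f x)) \<longlonglongrightarrow> 0"
proof -
  have "(\<lambda>n. \<integral>x. (cmod (s n x - f x))\<^sup>2 \<partial>M) \<longlonglongrightarrow> (\<integral>x. 0 \<partial>M)"
  proof (rule integral_dominated_convergence[where w = "\<lambda>x. (cmod (g x))\<^sup>2"])
    show "integrable M (\<lambda>x. (cmod (g x))\<^sup>2)"
      using assms(3) by (rule L2_integrable_power)
    show "AE x in M. norm ((cmod (s n x - f x))\<^sup>2) \<le> (cmod (g x))\<^sup>2" for n
      using bound by (auto intro!: AE_I2 power_mono)
    show "AE x in M. (\<lambda>n. (cmod (s n x - f x))\<^sup>2) \<longlonglongrightarrow> 0"
    proof (rule AE_I2)
      fix x assume "x \<in> space M"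
      then have "(\<lambda>n. (cmod (s n x - f x))\<^sup>2) \<longlonglongrightarrow> (cmod (f x - f x))\<^sup>2"
        using lim by (intro tendsto_intros) auto
      then show "(\<lambda>n. (cmod (s n x - f x))\<^sup>2) \<longlonglongrightarrow> 0"
        by simp
    qed
  qed (use assms in \<open>auto intro!: borel_measurable_power borel_measurable_norm\<close>)
  then have "(\<lambda>n. sqrt (\<integral>x. (cmod (s n x - f x))\<^sup>2 \<partial>M)) \<longlonglongrightarrow> sqrt 0"
    by (intro tendsto_real_sqrt) simp
  then show ?thesis
    by (simp add: L2_norm_def)
qed

section \<open>Product measures\<close>

context sigma_finite_measure
begin

text \<open>The exceptional set lies in a measurable null set \<open>Z\<close>; the measures of the
  sections of \<open>Z\<close> integrate to 0, so almost every section is null.\<close>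

lemma AE_pair_fst:
  assumes "AE z in N \<Otimes>\<^sub>M M. P z"
  shows "AE x in N. AE y in M. P (x, y)"
proof -
  from assms obtain Z where Z: "{z \<in> space (N \<Otimes>\<^sub>M M). \<not> P z} \<subseteq> Z"
    "emeasure (N \<Otimes>\<^sub>M M) Z = 0" "Z \<in> sets (N \<Otimes>\<^sub>M M)"
    by (rule AE_E)
  have "(\<integral>\<^sup>+x. emeasure M (Pair x -` Z) \<partial>N) = 0"
    using Z by (simp add: emeasure_pair_measure_alt)
  then have "AE x in N. emeasure M (Pair x -` Z) = 0"
    using measurable_emeasure_Pair[OF Z(3)] by (simp add: nn_integral_0_iff_AE)
  with AE_space show ?thesis
  proof eventually_elim
    case (elim x)
    then have "Pair x -` Z \<in> null_sets M"
      using Z(3) by (auto simp: sets_Pair1)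
    then show ?case
      using Z(1) elim by (intro AE_I'[of "Pair x -` Z"]) (auto simp: space_pair_measure)
  qed
qed

lemma AE_pair_snd:
  assumes "AE y in M. P y"
  shows "AE z in N \<Otimes>\<^sub>M M. P (snd z)"
proof -
  from assms obtain Z where Z: "{y \<in> space M. \<not> P y} \<subseteq> Z" "emeasure M Z = 0" "Z \<in> sets M"
    by (rule AE_E)
  then have "space N \<times> Z \<in> null_sets (N \<Otimes>\<^sub>M M)"
    by (intro times_in_null_sets2) auto
  then show ?thesis
    using Z(1) by (intro AE_I') (auto simp: space_pair_measure)
qed

text \<open>
  The Fubini theorem of the library needs both factors to be \<open>\<sigma>\<close>-finite; here this is
  required of the second one only, which spares a proof that the dual Haar measure is
  \<open>\<sigma>\<close>-finite.
\<close>

lemma AE_integrable_pair_fst: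
  fixes f :: "'b \<times> 'a \<Rightarrow> 'c::{banach, second_countable_topology}"
  assumes f: "integrable (N \<Otimes>\<^sub>M M) f"
  shows "AE x in N. integrable M (\<lambda>y. f (x, y))"
proof -
  have [measurable]: "f \<in> borel_measurable (N \<Otimes>\<^sub>M M)"
    using f by simp
  have "(\<integral>\<^sup>+x. \<integral>\<^sup>+y. ennreal (norm (f (x, y))) \<partial>M \<partial>N) < \<infinity>"
    using f nn_integral_fst[of "\<lambda>z. ennreal (norm (f z))" N] by (simp add: integrable_iff_bounded)
  then have "AE x in N. (\<integral>\<^sup>+y. ennreal (norm (f (x, y))) \<partial>M) \<noteq> \<infinity>"
    by (intro nn_integral_PInf_AE) auto
  with AE_space show ?thesis
    by eventually_elim (auto simp: integrable_iff_bounded less_top)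
qed

text \<open>Tonelli's theorem, packaged so that integrability of the section integrals comes with
  their value; this allows positive and negative parts to be subtracted afterwards.\<close>

lemma has_bochner_integral_pair_nonneg:
  fixes f :: "'b \<times> 'a \<Rightarrow> real"
  assumes f: "integrable (N \<Otimes>\<^sub>M M) f" and nonneg: "\<And>z. 0 \<le> f z"
  shows "has_bochner_integral N (\<lambda>x. \<integral>y. f (x, y) \<partial>M) (integral\<^sup>L (N \<Otimes>\<^sub>M M) f)"
proof (rule has_bochner_integral_nn_integral)
  have [measurable]: "f \<in> borel_measurable (N \<Otimes>\<^sub>M M)"
    using f by simp
  show "(\<lambda>x. \<integral>y. f (x, y) \<partial>M) \<in> borel_measurable N"
    by measurable
  have "(\<integral>\<^sup>+x. ennreal (\<integral>y. f (x, y) \<partial>M) \<partial>N) = (\<integral>\<^sup>+x. \<integral>\<^sup>+y. ennreal (f (x, y)) \<partial>M \<partial>N)"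
    \<comment> \<open>Where a section fails to be integrable its Bochner integral is 0 by default,
      while the extended integral is infinite; the two agree only for almost every x.\<close>
    using AE_integrable_pair_fst[OF f]
    by (intro nn_integral_cong_AE, eventually_elim) (simp add: nn_integral_eq_integral nonneg)
  also have "\<dots> = (\<integral>\<^sup>+z. ennreal (f z) \<partial>(N \<Otimes>\<^sub>M M))"
    by (rule nn_integral_fst) simp
  also have "\<dots> = ennreal (integral\<^sup>L (N \<Otimes>\<^sub>M M) f)"
    using f nonneg by (simp add: nn_integral_eq_integral)
  finally show "(\<integral>\<^sup>+x. ennreal (\<integral>y. f (x, y) \<partial>M) \<partial>N) = ennreal (integral\<^sup>L (N \<Otimes>\<^sub>M M) f)" .
qed (simp_all add: nonneg)

lemma has_bochner_integral_pair_real: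
  fixes f :: "'b \<times> 'a \<Rightarrow> real"
  assumes f: "integrable (N \<Otimes>\<^sub>M M) f"
  shows "has_bochner_integral N (\<lambda>x. \<integral>y. f (x, y) \<partial>M) (integral\<^sup>L (N \<Otimes>\<^sub>M M) f)"
proof -
  define p m where "p z = max (f z) 0" and "m z = max (- f z) 0" for z
  have [measurable]: "f \<in> borel_measurable (N \<Otimes>\<^sub>M M)"
    using f by simp
  have pm: "integrable (N \<Otimes>\<^sub>M M) p" "integrable (N \<Otimes>\<^sub>M M) m"
    using f unfolding p_def m_def by (auto intro: integrable_max)
  have [measurable]: "p \<in> borel_measurable (N \<Otimes>\<^sub>M M)" "m \<in> borel_measurable (N \<Otimes>\<^sub>M M)"
    using pm by auto
  have f_eq: "f = (\<lambda>z. p z - m z)"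
    by (auto simp: p_def m_def)
  have "has_bochner_integral N (\<lambda>x. (\<integral>y. p (x, y) \<partial>M) - (\<integral>y. m (x, y) \<partial>M))
      (integral\<^sup>L (N \<Otimes>\<^sub>M M) p - integral\<^sup>L (N \<Otimes>\<^sub>M M) m)"
    by (intro has_bochner_integral_diff has_bochner_integral_pair_nonneg pm) (auto simp: p_def m_def)
  \<comment> \<open>Linearity of the inner integral needs both sections integrable, which again
    holds off a null set.\<close>
  moreover have "AE x in N. (\<integral>y. p (x, y) \<partial>M) - (\<integral>y. m (x, y) \<partial>M) = (\<integral>y. f (x, y) \<partial>M)"
    using pm[THEN AE_integrable_pair_fst] by eventually_elim (simp add: f_eq)
  moreover have "integral\<^sup>L (N \<Otimes>\<^sub>M M) p - integral\<^sup>L (N \<Otimes>\<^sub>M M) m = integral\<^sup>L (N \<Otimes>\<^sub>M M) f"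
    using pm by (simp add: f_eq)
  ultimately show ?thesis
    by (subst has_bochner_integral_cong_AE[where g = "\<lambda>x. (\<integral>y. p (x, y) \<partial>M) - (\<integral>y. m (x, y) \<partial>M)"])
      (auto elim: eventually_mono)
qed

lemma integral_pair_fst:
  fixes f :: "'b \<times> 'a \<Rightarrow> complex"
  assumes f: "integrable (N \<Otimes>\<^sub>M M) f"
  shows "(\<integral>x. \<integral>y. f (x, y) \<partial>M \<partial>N) = integral\<^sup>L (N \<Otimes>\<^sub>M M) f"
proof -
  note Re = has_bochner_integral_pair_real[OF integrable_Re[OF f]]
  note Im = has_bochner_integral_pair_real[OF integrable_Im[OF f]]
  have [measurable]: "f \<in> borel_measurable (N \<Otimes>\<^sub>M M)"
    using f by simp
  have "(\<integral>x. \<integral>y. f (x, y) \<partial>M \<partial>N) =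
      (\<integral>x. of_real (\<integral>y. Re (f (x, y)) \<partial>M) + \<i> * of_real (\<integral>y. Im (f (x, y)) \<partial>M) \<partial>N)"
  proof (rule integral_cong_AE)
    show "AE x in N. (\<integral>y. f (x, y) \<partial>M) =
        of_real (\<integral>y. Re (f (x, y)) \<partial>M) + \<i> * of_real (\<integral>y. Im (f (x, y)) \<partial>M)"
      using AE_integrable_pair_fst[OF f]
      by eventually_elim (simp add: complex_eq_iff)
  qed measurable
  also have "\<dots> = of_real (integral\<^sup>L (N \<Otimes>\<^sub>M M) (\<lambda>z. Re (f z)))
      + \<i> * of_real (integral\<^sup>L (N \<Otimes>\<^sub>M M) (\<lambda>z. Im (f z)))"
    using Re Im by (simp add: has_bochner_integral_iff)
  also have "\<dots> = integral\<^sup>L (N \<Otimes>\<^sub>M M) f"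
    using f by (simp add: complex_eq_iff)
  finally show ?thesis .
qed

section \<open>Sections and elementary tensors in L2 of a product\<close>

lemma AE_L2_fst:
  assumes "f \<in> L2 (N \<Otimes>\<^sub>M M)"
  shows "AE x in N. (\<lambda>y. f (x, y)) \<in> L2 M"
  using AE_integrable_pair_fst[OF L2_integrable_power[OF assms]] AE_space
  by eventually_elim (use L2_measurable[OF assms] in \<open>auto simp: L2_def\<close>)

lemma L2_tensor:
  assumes "f \<in> L2 N" "g \<in> L2 M"
  shows "(\<lambda>(x, y). f x * g y) \<in> L2 (N \<Otimes>\<^sub>M M)"
proof -
  have [measurable]: "f \<in> borel_measurable N" "g \<in> borel_measurable M"
    using assms by (auto intro: L2_measurable)
  let ?F = "\<lambda>x. ennreal ((cmod (f x))\<^sup>2)" and ?G = "\<lambda>y. ennreal ((cmod (g y))\<^sup>2)"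
  have "(\<integral>\<^sup>+z. ennreal (norm ((cmod (case z of (x, y) \<Rightarrow> f x * g y))\<^sup>2)) \<partial>(N \<Otimes>\<^sub>M M)) =
      (\<integral>\<^sup>+z. ?F (fst z) * ?G (snd z) \<partial>(N \<Otimes>\<^sub>M M))"
    by (intro nn_integral_cong) (auto simp: norm_mult power_mult_distrib ennreal_mult' split: prod.split)
  also have "\<dots> = (\<integral>\<^sup>+x. \<integral>\<^sup>+y. ?F x * ?G y \<partial>M \<partial>N)"
    by (subst nn_integral_fst[symmetric]) auto
  also have "\<dots> = (\<integral>\<^sup>+x. ?F x \<partial>N) * (\<integral>\<^sup>+y. ?G y \<partial>M)"
    by (simp add: nn_integral_cmult nn_integral_multc)
  also have "\<dots> < \<infinity>"
    using assms[THEN L2_integrable_power] by (simp add: integrable_iff_bounded ennreal_mult_less_top)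
  finally have "integrable (N \<Otimes>\<^sub>M M) (\<lambda>z. (cmod (case z of (x, y) \<Rightarrow> f x * g y))\<^sup>2)"
    unfolding integrable_iff_bounded by simp
  then show ?thesis
    by (simp add: L2_def)
qed

lemma L2_inner_tensor:
  assumes "f \<in> L2 N" "g \<in> L2 M" "f' \<in> L2 N" "g' \<in> L2 M"
  shows "L2_inner (N \<Otimes>\<^sub>M M) (\<lambda>(x, y). f x * g y) (\<lambda>(x, y). f' x * g' y) =
    L2_inner N f f' * L2_inner M g g'"
proof -
  have "L2_inner (N \<Otimes>\<^sub>M M) (\<lambda>(x, y). f x * g y) (\<lambda>(x, y). f' x * g' y) =
      (\<integral>x. \<integral>y. (f x * cnj (f' x)) * (g y * cnj (g' y)) \<partial>M \<partial>N)"
    using integral_pair_fst[OF integrable_L2_inner[OF L2_tensor[OF assms(1,2)] L2_tensor[OF assms(3,4)]]]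
    by (simp add: L2_inner_def mult_ac)
  also have "\<dots> = L2_inner N f f' * L2_inner M g g'"
    by (simp only: integral_mult_right_zero integral_mult_left_zero L2_inner_def)
  finally show ?thesis .
qed

end

section \<open>Closed subspaces and elementary tensors\<close>

lemma L2_closed_subspaceD:
  assumes "L2_closed_subspace M D"
  shows "D \<subseteq> L2 M" "(\<lambda>x. 0) \<in> D"
    and "\<And>f g. f \<in> D \<Longrightarrow> g \<in> D \<Longrightarrow> (\<lambda>x. f x + g x) \<in> D"
    and "\<And>c f. f \<in> D \<Longrightarrow> (\<lambda>x. c * f x) \<in> D"
    and "\<And>s f. (\<And>n. s n \<in> D) \<Longrightarrow> f \<in> L2 M \<Longrightarrow> (\<lambda>n. L2_norm M (\<lambda>x. s n x - f x)) \<longlonglongrightarrow> 0 \<Longrightarrow> f \<in> D"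
  using assms unfolding L2_closed_subspace_def by blast+

lemma L2_closed_subspace_diff:
  assumes "L2_closed_subspace M D" "f \<in> D" "g \<in> D"
  shows "(\<lambda>x. f x - g x) \<in> D"
  using L2_closed_subspaceD(3)[OF assms(1,2) L2_closed_subspaceD(4)[OF assms(1,3), of "- 1"]] by simp

lemma L2_closed_subspace_sum:
  assumes D: "L2_closed_subspace M D" and "finite I" and "\<And>i. i \<in> I \<Longrightarrow> f i \<in> D"
  shows "(\<lambda>x. \<Sum>i\<in>I. f i x) \<in> D"
  using assms(2,3)
proof (induction I)
  case empty
  show ?case using L2_closed_subspaceD(2)[OF D] by simp
next
  case (insert i I)
  then show ?case using L2_closed_subspaceD(3)[OF D, of "f i"] by simp
qed

lemma L2_closed_subspace_cong_AE:
  assumes D: "L2_closed_subspace M D" and "f \<in> D" "g \<in> borel_measurable M" "AE x in M. f x = g x"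
  shows "g \<in> D"
proof -
  have f: "f \<in> L2 M"
    using assms by (auto dest: L2_closed_subspaceD(1))
  have g: "g \<in> L2 M"
    using assms(4) by (intro L2_cong_AE[OF f assms(3)]) (auto elim: eventually_mono)
  have "L2_norm M (\<lambda>x. f x - g x) = 0"
    using assms(4) by (subst L2_norm_eq_0_iff) (auto intro: L2_diff f g)
  then show ?thesis
    using L2_closed_subspaceD(5)[OF D, of "\<lambda>n. f" g] assms(2) g by simp
qed

lemma L2_indicator:
  assumes "Q \<in> sets M" "emeasure M Q < \<infinity>"
  shows "(indicator Q :: 'a \<Rightarrow> complex) \<in> L2 M"
proof -
  have "integrable M (indicator Q :: 'a \<Rightarrow> real)"
    using assms by simp
  moreover have "(\<lambda>x. (cmod (indicator Q x))\<^sup>2) = (indicator Q :: 'a \<Rightarrow> real)"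
    by (auto simp: indicator_def)
  ultimately show ?thesis
    using assms(1) by (simp add: L2_def)
qed

text \<open>Linear combinations of the indicators give the square-integrable simple functions, and
  these approximate every element of L2 by dominated convergence.\<close>

lemma L2_dense_indicator:
  assumes D: "L2_closed_subspace M D"
    and ind: "\<And>Q. Q \<in> sets M \<Longrightarrow> emeasure M Q < \<infinity> \<Longrightarrow> indicator Q \<in> D"
  shows "D = L2 M"
proof
  show "D \<subseteq> L2 M"
    using D by (rule L2_closed_subspaceD)
  have simple: "s \<in> D" if s: "simple_function M s" "s \<in> L2 M" for s
  proof -
    let ?Q = "\<lambda>y. s -` {y} \<inter> space M"
    have Q: "?Q y \<in> sets M" for y
      using s(1) by (rule simple_functionD)
    \<comment> \<open>The value 0 is left out, since its level set may have infinite
      measure.\<close>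
    have "(\<lambda>x. \<Sum>y\<in>s ` space M - {0}. y * indicator (?Q y) x) \<in> D"
    proof (intro L2_closed_subspace_sum[OF D] L2_closed_subspaceD(4)[OF D] ind)
      show "finite (s ` space M - {0})"
        using s(1) by (simp add: simple_functionD)
      fix y assume "y \<in> s ` space M - {0}"
      then have y: "y \<noteq> 0" by simp
      \<comment> \<open>Chebyshev's inequality: on the level set of y the quotient equals 1, so it
        dominates the indicator.\<close>
      have "integrable M (\<lambda>x. (cmod (s x))\<^sup>2 / (cmod y)\<^sup>2)"
        using L2_integrable_power[OF s(2)] by simp
      then have "integrable M (indicator (?Q y) :: 'a \<Rightarrow> real)"
        by (rule Bochner_Integration.integrable_bound)
          (use Q y in \<open>auto simp: indicator_def\<close>)
      then show "emeasure M (?Q y) < \<infinity>"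
        using Q by (simp add: integrable_indicator_iff Int_absorb2)
    qed (rule Q)
    moreover have "AE x in M. (\<Sum>y\<in>s ` space M - {0}. y * indicator (?Q y) x) = s x"
    proof (rule AE_I2)
      fix x assume x: "x \<in> space M"
      have "(\<Sum>y\<in>s ` space M - {0}. y * indicator (?Q y) x) =
          (\<Sum>y\<in>s ` space M - {0}. if s x = y then y else 0)"
        using x by (intro sum.cong) (auto simp: indicator_def)
      also have "\<dots> = s x"
        using s(1) x by (simp add: simple_functionD)
      finally show "(\<Sum>y\<in>s ` space M - {0}. y * indicator (?Q y) x) = s x" .
    qed
    ultimately show ?thesis
      by (intro L2_closed_subspace_cong_AE[OF D _ L2_measurable[OF s(2)]])
  qed
  show "L2 M \<subseteq> D"
  proof
    fix f assume f: "f \<in> L2 M"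
    obtain s where s: "\<forall>i. simple_function M (s i)" "\<forall>x\<in>space M. (\<lambda>i. s i x) \<longlonglongrightarrow> f x"
      "\<forall>i. \<forall>x\<in>space M. dist (s i x) 0 \<le> 2 * dist (f x) 0"
      using borel_measurable_implies_sequence_metric[OF L2_measurable[OF f], of 0] by (elim exE conjE)
    have s_le: "cmod (s i x) \<le> 2 * cmod (f x)" if "x \<in> space M" for i x
      using s(3) that by simp
    have s_L2: "s i \<in> L2 M" for i
    proof (rule L2I_bound)
      show "integrable M (\<lambda>x. 4 * (cmod (f x))\<^sup>2)"
        using L2_integrable_power[OF f] by simp
      show "AE x in M. (cmod (s i x))\<^sup>2 \<le> 4 * (cmod (f x))\<^sup>2"
        using power_mono[OF s_le, where n = 2] by (intro AE_I2) (simp add: power_mult_distrib)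
    qed (use s(1) in \<open>auto intro: borel_measurable_simple_function\<close>)
    have "(\<lambda>n. L2_norm M (\<lambda>x. s n x - f x)) \<longlonglongrightarrow> 0"
    proof (rule L2_dominated_convergence)
      \<comment> \<open>The approximants are bounded by twice |f|, hence differ from f by at most
        three times |f|.\<close>
      show "(\<lambda>x. 3 * f x) \<in> L2 M"
        using f by (rule L2_scale)
      show "cmod (s n x - f x) \<le> cmod (3 * f x)" if "x \<in> space M" for n x
        using norm_triangle_ineq4[of "s n x" "f x"] s_le[OF that, of n] by (simp add: norm_mult)
    qed (use f s_L2 s(2) in \<open>auto intro: L2_measurable\<close>)
    then show "f \<in> D"
      by (rule L2_closed_subspaceD(5)[OF D simple[OF spec[OF s(1)] s_L2] f])
  qed
qed

text \<open>Indicators of rectangles are tensors, and a Dynkin argument passes to all measurable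
  sets. Complements would leave the sets of finite measure, so the argument runs inside a fixed box
  of finite measure, and boxes exhausting the product finish the proof.\<close>

lemma L2_dense_tensor:
  fixes A :: "'a measure" and B :: "'b measure"
  assumes "sigma_finite_measure A" "sigma_finite_measure B"
    and D: "L2_closed_subspace (A \<Otimes>\<^sub>M B) D"
    and tensor: "\<And>f g. f \<in> L2 A \<Longrightarrow> g \<in> L2 B \<Longrightarrow> (\<lambda>(x, y). f x * g y) \<in> D"
  shows "D = L2 (A \<Otimes>\<^sub>M B)"
proof (rule L2_dense_indicator[OF D])
  interpret A: sigma_finite_measure A by fact
  interpret B: sigma_finite_measure B by fact
  let ?M = "A \<Otimes>\<^sub>M B"
  have rect: "indicator (a \<times> b) \<in> D"
    if "a \<in> sets A" "emeasure A a < \<infinity>" "b \<in> sets B" "emeasure B b < \<infinity>" for a b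
    using tensor[OF L2_indicator[OF that(1,2)] L2_indicator[OF that(3,4)]]
    by (rule back_subst[where P = "\<lambda>f. f \<in> D"]) (auto simp: indicator_def fun_eq_iff)
  have box: "indicator (Q \<inter> (a0 \<times> b0)) \<in> D"
    if ab: "a0 \<in> sets A" "emeasure A a0 < \<infinity>" "b0 \<in> sets B" "emeasure B b0 < \<infinity>"
      and Q: "Q \<in> sets ?M" for a0 b0 Q
  proof -
    let ?E = "a0 \<times> b0"
    have E: "?E \<in> sets ?M" "?E \<subseteq> space A \<times> space B"
      using ab by (auto dest: sets.sets_into_space)
    have E_fin: "emeasure ?M ?E < \<infinity>"
      using ab by (simp add: B.emeasure_pair_measure_Times ennreal_mult_less_top)
    have fin: "indicator (X \<inter> ?E) \<in> L2 ?M" if "X \<in> sets ?M" for X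
    proof (rule L2_indicator)
      show "emeasure ?M (X \<inter> ?E) < \<infinity>"
        using E_fin emeasure_mono[of "X \<inter> ?E" ?E ?M] E by (auto intro: le_less_trans)
    qed (use that E in auto)
    have "Q \<in> sigma_sets (space A \<times> space B) {a \<times> b |a b. a \<in> sets A \<and> b \<in> sets B}"
      using Q by (simp add: sets_pair_measure)
    with Int_stable_pair_measure_generator pair_measure_closed show ?thesis
    proof (induction rule: sigma_sets_induct_disjoint)
      case (basic X)
      then obtain a b where X: "X = a \<times> b" "a \<in> sets A" "b \<in> sets B"
        by auto
      then have "X \<inter> ?E = (a \<inter> a0) \<times> (b \<inter> b0)"
        by auto
      moreover have "indicator ((a \<inter> a0) \<times> (b \<inter> b0)) \<in> D"
        using X ab emeasure_mono[of "a \<inter> a0" a0 A] emeasure_mono[of "b \<inter> b0" b0 B]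
        by (intro rect) (auto intro: le_less_trans)
      ultimately show ?case by simp
    next
      case empty
      then show ?case using L2_closed_subspaceD(2)[OF D] by simp
    next
      \<comment> \<open>The complement is taken relative to the box, where it is a difference of two
        members of \<open>D\<close>.\<close>
      case (compl X)
      have "(\<lambda>z. indicator ?E z - indicator (X \<inter> ?E) z) \<in> D"
        by (intro L2_closed_subspace_diff[OF D] compl rect ab)
      also have "(\<lambda>z. indicator ?E z - indicator (X \<inter> ?E) z :: complex) =
          indicator ((space A \<times> space B - X) \<inter> ?E)"
        using E(2) by (auto simp: fun_eq_iff indicator_def)
      finally show ?case .
    next
      case (union X)
      then have X: "X i \<in> sets ?M" for i
        by (auto simp: sets_pair_measure)
      \<comment> \<open>Disjointness makes the indicator of a finite partial union a sum of members
        of \<open>D\<close>; the full union is its norm limit, dominated by its own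
        indicator.\<close>
      let ?s = "\<lambda>n. indicator ((\<Union>i<n. X i) \<inter> ?E) :: _ \<Rightarrow> complex"
      have sum_D: "(\<lambda>z. \<Sum>i<n. indicator (X i \<inter> ?E) z) \<in> D" for n
        by (intro L2_closed_subspace_sum[OF D] union) auto
      have "disjoint_family_on (\<lambda>i. X i \<inter> ?E) {..<n}" for n
        using union(1) by (auto simp: disjoint_family_on_def)
      then have ind: "indicator (\<Union>i<n. X i \<inter> ?E) z = (\<Sum>i<n. indicator (X i \<inter> ?E) z :: complex)" for n z
        by (rule indicator_UN_disjoint[OF finite_lessThan])
      have UN: "(\<Union>i<n. X i) \<inter> ?E = (\<Union>i<n. X i \<inter> ?E)" for n
        by blast
      have "?s n = (\<lambda>z. \<Sum>i<n. indicator (X i \<inter> ?E) z)" for n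
        unfolding UN by (rule ext) (rule ind)
      with sum_D have "?s n \<in> D" for n
        by simp
      then show ?case
      proof (rule L2_closed_subspaceD(5)[OF D])
        show lim_L2: "indicator ((\<Union>i. X i) \<inter> ?E) \<in> L2 ?M"
          using X by (intro fin) auto
        show "(\<lambda>n. L2_norm ?M (\<lambda>z. ?s n z - indicator ((\<Union>i. X i) \<inter> ?E) z)) \<longlonglongrightarrow> 0"
        proof (rule L2_dominated_convergence)
          fix z
          show "(\<lambda>n. ?s n z) \<longlonglongrightarrow> indicator ((\<Union>i. X i) \<inter> ?E) z"
            using LIMSEQ_indicator_UN[of "\<lambda>i. X i \<inter> ?E" z] by simp
          show "cmod (?s n z - indicator ((\<Union>i. X i) \<inter> ?E) z)
              \<le> cmod (indicator ((\<Union>i. X i) \<inter> ?E) z)" for n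
            by (auto simp: indicator_def)
        qed (use X E lim_L2 in \<open>auto intro!: borel_measurable_indicator\<close>)
      qed
    qed
  qed
  fix Q assume Q: "Q \<in> sets ?M" "emeasure ?M Q < \<infinity>"
  obtain a where a: "range a \<subseteq> sets A" "(\<Union>i. a i) = space A" "\<And>i. emeasure A (a i) \<noteq> \<infinity>" "incseq a"
    by (rule A.sigma_finite_incseq) (rule that)
  obtain b where b: "range b \<subseteq> sets B" "(\<Union>i. b i) = space B" "\<And>i. emeasure B (b i) \<noteq> \<infinity>" "incseq b"
    by (rule B.sigma_finite_incseq) (rule that)
  \<comment> \<open>Both exhaustions increase, so the diagonal boxes already cover everything: a
    point of \<open>a i\<close> times \<open>b j\<close> lies in the box with index
    \<open>max i j\<close>.\<close>
  let ?Q = "\<lambda>n. Q \<inter> (a n \<times> b n)"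
  have inc: "incseq ?Q"
    using a(4) b(4) by (fastforce simp: incseq_def)
  have UN: "(\<Union>n. ?Q n) = Q"
  proof -
    have "\<exists>n. x \<in> a n \<and> y \<in> b n" if xy: "(x, y) \<in> Q" for x y
    proof -
      have "x \<in> (\<Union>i. a i)" "y \<in> (\<Union>i. b i)"
        using xy sets.sets_into_space[OF Q(1)] unfolding a(2) b(2) by (auto simp: space_pair_measure)
      then obtain i j where "x \<in> a i" "y \<in> b j" by auto
      then have "x \<in> a (max i j)" "y \<in> b (max i j)"
        using a(4) b(4) unfolding incseq_def by (meson max.cobounded1 max.cobounded2 subsetD)+
      then show ?thesis by blast
    qed
    then show ?thesis by auto
  qed
  have meas: "?Q n \<in> sets ?M" for n
    using a(1) b(1) Q(1) by auto
  have "indicator (?Q n) \<in> D" for n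
    using a b Q(1) by (intro box) (auto simp: less_top)
  then show "indicator Q \<in> D"
  proof (rule L2_closed_subspaceD(5)[OF D])
    show "indicator Q \<in> L2 ?M"
      using Q by (rule L2_indicator)
    show "(\<lambda>n. L2_norm ?M (\<lambda>z. indicator (?Q n) z - indicator Q z)) \<longlonglongrightarrow> 0"
    proof (rule L2_dominated_convergence)
      show "(\<lambda>n. indicator (?Q n) z :: complex) \<longlonglongrightarrow> indicator Q z" for z
        using LIMSEQ_indicator_incseq[OF inc, of z] by (simp only: UN)
      show "cmod (indicator (?Q n) z - indicator Q z) \<le> cmod (indicator Q z)" for n z
        by (auto simp: indicator_def)
      show "indicator Q \<in> L2 ?M"
        using Q by (rule L2_indicator)
    qed (use meas Q in \<open>auto intro!: borel_measurable_indicator\<close>)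
  qed
qed

section \<open>Orthogonal projections\<close>

text \<open>The difference f - g itself belongs to \<open>H\<close> and serves as the test
  vector.\<close>

lemma L2_subspace_inner_unique:
  assumes H: "L2_closed_subspace M H" and "f \<in> H" "g \<in> H"
    and eq: "\<And>h. h \<in> H \<Longrightarrow> L2_inner M f h = L2_inner M g h"
  shows "AE x in M. f x = g x"
proof -
  have L2: "f \<in> L2 M" "g \<in> L2 M"
    using assms L2_closed_subspaceD(1)[OF H] by auto
  have d: "(\<lambda>x. f x - g x) \<in> H"
    by (rule L2_closed_subspace_diff[OF H assms(2,3)])
  have "L2_inner M (\<lambda>x. f x - g x) (\<lambda>x. f x - g x) = 0"
    using L2 eq[OF d] by (simp add: L2_inner_diff_left L2_diff)
  then have "L2_norm M (\<lambda>x. f x - g x) = 0"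
    by (simp add: L2_inner_self)
  then show ?thesis
    using L2 by (simp add: L2_norm_eq_0_iff L2_diff)
qed

context
  fixes M :: "'a measure" and H P
  assumes H: "L2_closed_subspace M H" and P: "is_L2_projection_onto M H P"
begin

lemma L2_projection_in: "f \<in> L2 M \<Longrightarrow> P f \<in> H"
  using P by (auto simp: is_L2_projection_onto_def)

lemma L2_projection_in_L2: "f \<in> L2 M \<Longrightarrow> P f \<in> L2 M"
  using L2_projection_in L2_closed_subspaceD(1)[OF H] by blast

lemma L2_projection_inner:
  assumes "f \<in> L2 M" "h \<in> H"
  shows "L2_inner M (P f) h = L2_inner M f h"
proof -
  have "h \<in> L2 M"
    using assms(2) L2_closed_subspaceD(1)[OF H] by blast
  then have "L2_inner M f h - L2_inner M (P f) h = L2_inner M (\<lambda>x. f x - P f x) h"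
    using assms(1) by (simp add: L2_inner_diff_left L2_projection_in_L2)
  also have "\<dots> = 0"
    using P assms by (auto simp: is_L2_projection_onto_def)
  finally show ?thesis by simp
qed

text \<open>\<open>P\<close> is only a function satisfying an orthogonality condition. Its
  additivity, homogeneity and compatibility with null sets, as well as the commutation with
  translations, are all derived from this criterion.\<close>

lemma L2_projection_eqI:
  assumes "f \<in> L2 M" "g \<in> H" "\<And>h. h \<in> H \<Longrightarrow> L2_inner M f h = L2_inner M g h"
  shows "AE x in M. P f x = g x"
  using assms by (intro L2_subspace_inner_unique[OF H]) (auto simp: L2_projection_in L2_projection_inner)

lemma L2_projection_fixed: "f \<in> H \<Longrightarrow> AE x in M. P f x = f x"
  using L2_closed_subspaceD(1)[OF H] by (intro L2_projection_eqI) auto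

lemma L2_projection_add:
  assumes "f \<in> L2 M" "g \<in> L2 M"
  shows "AE x in M. P (\<lambda>x. f x + g x) x = P f x + P g x"
proof (rule L2_projection_eqI)
  show "(\<lambda>x. P f x + P g x) \<in> H"
    using assms by (intro L2_closed_subspaceD(3)[OF H] L2_projection_in)
  fix h assume h: "h \<in> H"
  then show "L2_inner M (\<lambda>x. f x + g x) h = L2_inner M (\<lambda>x. P f x + P g x) h"
    using assms L2_closed_subspaceD(1)[OF H]
    by (simp add: L2_inner_add_left L2_projection_in_L2 L2_projection_inner subsetD)
qed (rule L2_add[OF assms])

lemma L2_projection_scale:
  assumes "f \<in> L2 M"
  shows "AE x in M. P (\<lambda>x. c * f x) x = c * P f x"
proof (rule L2_projection_eqI)
  show "(\<lambda>x. c * P f x) \<in> H"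
    using assms by (intro L2_closed_subspaceD(4)[OF H] L2_projection_in)
  fix h assume h: "h \<in> H"
  then show "L2_inner M (\<lambda>x. c * f x) h = L2_inner M (\<lambda>x. c * P f x) h"
    using assms by (simp add: L2_inner_scale_left L2_projection_inner)
qed (rule L2_scale[OF assms])

lemma L2_projection_cong:
  assumes "f \<in> L2 M" "g \<in> L2 M" "AE x in M. f x = g x"
  shows "AE x in M. P f x = P g x"
proof (rule L2_projection_eqI)
  fix h assume h: "h \<in> H"
  then have "h \<in> L2 M"
    using L2_closed_subspaceD(1)[OF H] by blast
  then show "L2_inner M f h = L2_inner M (P g) h"
    using h assms by (simp add: L2_projection_inner L2_inner_cong_AE[of f M g h h])
qed (use assms in \<open>auto intro: L2_projection_in\<close>)

text \<open>Since \<open>P f\<close> is in \<open>H\<close>, testing f against it is the same as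
  testing \<open>P f\<close> against it. Vanishing of \<open>P f\<close> can thus be detected by a
  single scalar, which for a measurable family of projections depends measurably on the
  parameter.\<close>

lemma L2_projection_quadratic:
  assumes "f \<in> L2 M"
  shows "L2_inner M (P f) f = of_real ((L2_norm M (P f))\<^sup>2)"
  unfolding L2_inner_commute[of M "P f" f] L2_projection_inner[OF assms L2_projection_in[OF assms], symmetric]
  by (simp add: L2_inner_self)

lemma L2_projection_norm_le:
  assumes "f \<in> L2 M"
  shows "L2_norm M (P f) \<le> L2_norm M f"
proof (cases "L2_norm M (P f) = 0")
  case False
  have "(L2_norm M (P f))\<^sup>2 \<le> L2_norm M (P f) * L2_norm M f"
    using L2_Cauchy_Schwarz[OF L2_projection_in_L2[OF assms] assms]
    by (simp add: L2_projection_quadratic[OF assms] norm_power)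
  then show ?thesis
    using False L2_norm_nonneg[of M "P f"] by (simp add: power2_eq_square)
qed (simp add: L2_norm_nonneg)

lemma L2_bounded_op_toeplitz:
  assumes \<phi>: "\<phi> \<in> Linf M"
  shows "L2_bounded_op M H M H (toeplitz P \<phi>)"
proof -
  have L2: "f \<in> L2 M" if "f \<in> H" for f
    using that L2_closed_subspaceD(1)[OF H] by blast
  note mult = L2_mult_Linf[OF \<phi> L2]
  obtain C where C: "0 \<le> C" "AE x in M. cmod (\<phi> x) \<le> C"
    using \<phi> by (rule LinfE)
  have "L2_norm M (P (\<lambda>x. \<phi> x * f x)) \<le> C * L2_norm M f" if "f \<in> H" for f
    using L2_projection_norm_le[OF mult[OF that]] L2_norm_mult_Linf_le[OF _ C L2[OF that]] \<phi>
    by (auto simp: Linf_def intro: order_trans)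
  then show ?thesis
    using L2_projection_add[OF mult mult] L2_projection_scale[OF mult] L2_projection_in[OF mult]
    unfolding L2_bounded_op_def L2_eq_def toeplitz_def
    by (auto simp: algebra_simps)
qed

end

section \<open>Bounded operators and tensor products with the identity\<close>

lemma L2_bounded_opD:
  assumes "L2_bounded_op M H N K S"
  shows "\<And>f. f \<in> H \<Longrightarrow> S f \<in> K"
    and "\<And>f g. f \<in> H \<Longrightarrow> g \<in> H \<Longrightarrow> AE y in N. S (\<lambda>x. f x + g x) y = S f y + S g y"
    and "\<And>c f. f \<in> H \<Longrightarrow> AE y in N. S (\<lambda>x. c * f x) y = c * S f y"
    and "\<exists>C. \<forall>f\<in>H. L2_norm N (S f) \<le> C * L2_norm M f"
  using assms unfolding L2_bounded_op_def L2_eq_def by blast+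

context
  fixes M :: "'a measure" and N :: "'b measure" and S
  assumes S: "L2_bounded_op M (L2 M) N (L2 N) S"
begin

lemma L2_bounded_op_diff:
  assumes "f \<in> L2 M" "g \<in> L2 M"
  shows "AE y in N. S (\<lambda>x. f x - g x) y = S f y - S g y"
proof -
  have "AE y in N. S (\<lambda>x. f x + - 1 * g x) y = S f y + S (\<lambda>x. - 1 * g x) y"
    using L2_bounded_opD(2)[OF S assms(1) L2_scale[OF assms(2)]] .
  moreover have "AE y in N. S (\<lambda>x. - 1 * g x) y = - 1 * S g y"
    using L2_bounded_opD(3)[OF S assms(2)] .
  ultimately show ?thesis
    by eventually_elim simp
qed

lemma L2_bounded_op_diff_norm:
  assumes "f \<in> L2 M" "g \<in> L2 M"
  shows "L2_norm N (\<lambda>y. S f y - S g y) = L2_norm N (S (\<lambda>x. f x - g x))"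
  using L2_bounded_op_diff[OF assms] assms
  by (intro L2_norm_cong_AE L2_diff L2_bounded_opD(1)[OF S]) (auto elim: eventually_mono)

lemma L2_bounded_op_tendsto:
  assumes "\<And>n. s n \<in> L2 M" "f \<in> L2 M" "(\<lambda>n. L2_norm M (\<lambda>x. s n x - f x)) \<longlonglongrightarrow> 0"
  shows "(\<lambda>n. L2_norm N (\<lambda>y. S (s n) y - S f y)) \<longlonglongrightarrow> 0"
proof -
  obtain C where C: "\<And>f. f \<in> L2 M \<Longrightarrow> L2_norm N (S f) \<le> C * L2_norm M f"
    using L2_bounded_opD(4)[OF S] by blast
  show ?thesis
  proof (rule Lim_null_comparison)
    show "\<forall>\<^sub>F n in sequentially. norm (L2_norm N (\<lambda>y. S (s n) y - S f y))
        \<le> C * L2_norm M (\<lambda>x. s n x - f x)"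
      using C[OF L2_diff[OF assms(1,2)]]
      by (simp add: L2_bounded_op_diff_norm[OF assms(1,2)] L2_norm_nonneg)
    show "(\<lambda>n. C * L2_norm M (\<lambda>x. s n x - f x)) \<longlonglongrightarrow> 0"
      using tendsto_mult_right_zero[OF assms(3)] .
  qed
qed

text \<open>The constant sequence f converges in the seminorm to g as well as to f; continuity of
  \<open>S\<close> and uniqueness of limits conclude.\<close>

lemma L2_bounded_op_cong:
  assumes "f \<in> L2 M" "g \<in> L2 M" "AE x in M. f x = g x"
  shows "AE y in N. S f y = S g y"
proof (rule L2_limit_unique)
  have "L2_norm M (\<lambda>x. f x - g x) = 0"
    using assms by (simp add: L2_norm_eq_0_iff L2_diff)
  then show "(\<lambda>n. L2_norm N (\<lambda>y. S f y - S g y)) \<longlonglongrightarrow> 0"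
    using L2_bounded_op_tendsto[of "\<lambda>n. f" g] assms(1,2) by simp
  show "(\<lambda>n. L2_norm N (\<lambda>y. S f y - S f y)) \<longlonglongrightarrow> 0"
    by (simp add: L2_norm_def)
qed (use assms in \<open>auto intro: L2_bounded_opD(1)[OF S]\<close>)

text \<open>Both sides are linear and continuous in f for fixed h and k. With k equal to
  \<open>S h\<close> this is the form in which preservation of inner products extends from tensors
  by density.\<close>

lemma L2_closed_subspace_inner_eq:
  assumes "h \<in> L2 M" "k \<in> L2 N"
  shows "L2_closed_subspace M {f \<in> L2 M. L2_inner N (S f) k = L2_inner M f h}"
proof -
  note S_L2 = L2_bounded_opD(1)[OF S]
  \<comment> \<open>The zero function is 0 times itself, so homogeneity of \<open>S\<close> gives
    the value 0 almost everywhere.\<close>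
  have zero: "L2_inner N (S (\<lambda>x. 0)) k = L2_inner M (\<lambda>x. 0) h"
    using L2_bounded_opD(3)[OF S L2_zero, of 0] S_L2 assms(2) L2_zero
      L2_inner_cong_AE[of "S (\<lambda>x. 0)" N "\<lambda>x. 0" k k]
    by (auto simp: L2_inner_def L2_zero)
  have add: "L2_inner N (S (\<lambda>x. f x + g x)) k = L2_inner N (S f) k + L2_inner N (S g) k"
    if "f \<in> L2 M" "g \<in> L2 M" for f g
    using L2_inner_cong_AE[OF _ _ _ _ L2_bounded_opD(2)[OF S that], where g = k and g' = k] that assms
    by (simp add: S_L2 L2_add L2_inner_add_left)
  have scale: "L2_inner N (S (\<lambda>x. c * f x)) k = c * L2_inner N (S f) k"
    if "f \<in> L2 M" for f c
    using L2_inner_cong_AE[OF _ _ _ _ L2_bounded_opD(3)[OF S that], where g = k and g' = k] that assms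
    by (simp add: S_L2 L2_scale L2_inner_scale_left)
  have lim: "L2_inner N (S f) k = L2_inner M f h"
    if s: "\<And>n. s n \<in> L2 M" "\<And>n. L2_inner N (S (s n)) k = L2_inner M (s n) h"
      and f: "f \<in> L2 M" "(\<lambda>n. L2_norm M (\<lambda>x. s n x - f x)) \<longlonglongrightarrow> 0" for s f
  proof (rule LIMSEQ_unique)
    show "(\<lambda>n. L2_inner N (S (s n)) k) \<longlonglongrightarrow> L2_inner N (S f) k"
      using s f assms by (intro L2_inner_tendsto_left L2_bounded_op_tendsto S_L2)
    show "(\<lambda>n. L2_inner N (S (s n)) k) \<longlonglongrightarrow> L2_inner M f h"
      unfolding s(2) using s(1) f assms by (intro L2_inner_tendsto_left)
  qed
  show ?thesis
    unfolding L2_closed_subspace_def using assms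
    by (auto simp: zero L2_zero add L2_add L2_inner_add_left scale L2_scale L2_inner_scale_left
        intro: lim)
qed

end

text \<open>Polarisation: the norm of a sum determines the real part of the inner product, and
  replacing f by \<i> f determines the imaginary part.\<close>

lemma L2_unitary_inner:
  assumes S: "L2_unitary M (L2 M) N (L2 N) S" and f: "f \<in> L2 M" and g: "g \<in> L2 M"
  shows "L2_inner N (S f) (S g) = L2_inner M f g"
proof -
  have B: "L2_bounded_op M (L2 M) N (L2 N) S"
    and norm: "\<And>f. f \<in> L2 M \<Longrightarrow> L2_norm N (S f) = L2_norm M f"
    using S by (auto simp: L2_unitary_def)
  note S_L2 = L2_bounded_opD(1)[OF B]
  have Re: "Re (L2_inner N (S f) (S g)) = Re (L2_inner M f g)" if "f \<in> L2 M" "g \<in> L2 M" for f g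
  proof -
    have "L2_norm N (\<lambda>y. S f y + S g y) = L2_norm N (S (\<lambda>x. f x + g x))"
      using L2_bounded_opD(2)[OF B that] that
      by (intro L2_norm_cong_AE L2_add S_L2) (auto elim: eventually_mono)
    then show ?thesis
      using L2_norm_add_power2[OF S_L2 S_L2, OF that] L2_norm_add_power2[OF that] that
      by (simp add: norm L2_add)
  qed
  have "L2_inner N (S (\<lambda>x. \<i> * f x)) (S g) = L2_inner N (\<lambda>y. \<i> * S f y) (S g)"
    using L2_bounded_opD(3)[OF B f] f g by (intro L2_inner_cong_AE L2_scale S_L2) auto
  then have "Im (L2_inner N (S f) (S g)) = Im (L2_inner M f g)"
    using Re[OF L2_scale[OF f, of \<i>] g] by (simp add: L2_inner_scale_left)
  then show ?thesis
    using Re[OF f g] by (simp add: complex_eq_iff)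
qed

lemma (in sigma_finite_measure) Linf_snd:
  assumes "\<psi> \<in> Linf M"
  shows "(\<lambda>z. \<psi> (snd z)) \<in> Linf (N \<Otimes>\<^sub>M M)"
proof -
  have [measurable]: "\<psi> \<in> borel_measurable M"
    using assms by (simp add: Linf_def)
  obtain C where "AE y in M. cmod (\<psi> y) \<le> C"
    using assms by (auto simp: Linf_def)
  then have "AE z in N \<Otimes>\<^sub>M M. cmod (\<psi> (snd z)) \<le> C"
    by (rule AE_pair_snd)
  then show ?thesis
    unfolding Linf_def by auto
qed

section \<open>F tensor I: preservation of inner products and commutation with functions of the
  second variable\<close>

context
  fixes M :: "'a measure" and N :: "'b measure" and L :: "'y measure" and F FI
  assumes M: "sigma_finite_measure M" and L: "sigma_finite_measure L"
    and F: "L2_unitary M (L2 M) N (L2 N) F" and FI: "is_tensor_id M N L F FI"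
begin

interpretation L: sigma_finite_measure L by (rule L)

lemma tensor_id_bounded:
  "L2_bounded_op (M \<Otimes>\<^sub>M L) (L2 (M \<Otimes>\<^sub>M L)) (N \<Otimes>\<^sub>M L) (L2 (N \<Otimes>\<^sub>M L)) FI"
  using FI by (simp add: is_tensor_id_def)

lemma tensor_id_tensor:
  assumes "f \<in> L2 M" "g \<in> L2 L"
  shows "AE z in N \<Otimes>\<^sub>M L. FI (\<lambda>(x, v). f x * g v) z = (case z of (y, v) \<Rightarrow> F f y * g v)"
  using FI assms by (simp add: is_tensor_id_def L2_eq_def)

lemma unitary_in_L2: "f \<in> L2 M \<Longrightarrow> F f \<in> L2 N"
  using F by (auto simp: L2_unitary_def L2_bounded_op_def)

text \<open>Inner products of tensors factor, so there the claim is the unitarity of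
  \<open>F\<close>. Density is then applied twice, once in each argument.\<close>

lemma tensor_id_inner:
  assumes f: "f \<in> L2 (M \<Otimes>\<^sub>M L)" and h: "h \<in> L2 (M \<Otimes>\<^sub>M L)"
  shows "L2_inner (N \<Otimes>\<^sub>M L) (FI f) (FI h) = L2_inner (M \<Otimes>\<^sub>M L) f h"
proof -
  note FI_L2 = L2_bounded_opD(1)[OF tensor_id_bounded]
  let ?D = "\<lambda>h. {f \<in> L2 (M \<Otimes>\<^sub>M L).
      L2_inner (N \<Otimes>\<^sub>M L) (FI f) (FI h) = L2_inner (M \<Otimes>\<^sub>M L) f h}"
  have D: "?D h = L2 (M \<Otimes>\<^sub>M L)" if h: "h \<in> L2 (M \<Otimes>\<^sub>M L)"
    and tensor: "\<And>f g. f \<in> L2 M \<Longrightarrow> g \<in> L2 L \<Longrightarrow> (\<lambda>(x, v). f x * g v) \<in> ?D h" for h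
    by (rule L2_dense_tensor[OF M L L2_closed_subspace_inner_eq[OF tensor_id_bounded h FI_L2[OF h]]])
      (rule tensor)
  have tt: "L2_inner (N \<Otimes>\<^sub>M L) (FI (\<lambda>(x, v). f x * g v)) (FI (\<lambda>(x, v). f' x * g' v)) =
      L2_inner (M \<Otimes>\<^sub>M L) (\<lambda>(x, v). f x * g v) (\<lambda>(x, v). f' x * g' v)"
    if "f \<in> L2 M" "g \<in> L2 L" "f' \<in> L2 M" "g' \<in> L2 L" for f g f' g'
  proof -
    have "L2_inner (N \<Otimes>\<^sub>M L) (FI (\<lambda>(x, v). f x * g v)) (FI (\<lambda>(x, v). f' x * g' v)) =
        L2_inner (N \<Otimes>\<^sub>M L) (\<lambda>(y, v). F f y * g v) (\<lambda>(y, v). F f' y * g' v)"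
      using that by (intro L2_inner_cong_AE tensor_id_tensor FI_L2 L.L2_tensor unitary_in_L2)
    also have "\<dots> = L2_inner N (F f) (F f') * L2_inner L g g'"
      using that by (intro L.L2_inner_tensor unitary_in_L2)
    finally show ?thesis
      using that by (simp add: L2_unitary_inner[OF F] L.L2_inner_tensor)
  qed
  \<comment> \<open>First pass: the right argument stays a tensor while the left one becomes
    arbitrary.\<close>
  have tensor_right: "L2_inner (N \<Otimes>\<^sub>M L) (FI f) (FI (\<lambda>(x, v). f' x * g' v)) =
      L2_inner (M \<Otimes>\<^sub>M L) f (\<lambda>(x, v). f' x * g' v)"
    if "f' \<in> L2 M" "g' \<in> L2 L" "f \<in> L2 (M \<Otimes>\<^sub>M L)" for f f' g'
    using D[OF L.L2_tensor[OF that(1,2)]] tt[OF _ _ that(1,2)] that(3) L.L2_tensor by blast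
  \<comment> \<open>Second pass: conjugate symmetry moves the tensor to the left, now against the
    arbitrary \<open>h\<close>.\<close>
  have "(\<lambda>(x, v). f x * g v) \<in> ?D h" if "f \<in> L2 M" "g \<in> L2 L" for f g
    using tensor_right[OF that h] L.L2_tensor[OF that]
      L2_inner_commute[of "N \<Otimes>\<^sub>M L" _ "FI h"] L2_inner_commute[of "M \<Otimes>\<^sub>M L" _ h]
    by simp
  then show ?thesis
    using D[OF h] f by blast
qed

text \<open>On an elementary tensor the multiplier is absorbed into the second factor, on which F
  tensor I acts as the identity. Both sides are continuous in f, so the functions satisfying the
  identity form a closed subspace.\<close>

lemma tensor_id_mult_snd:
  assumes \<psi>: "\<psi> \<in> Linf L" and f: "f \<in> L2 (M \<Otimes>\<^sub>M L)"
  shows "AE z in N \<Otimes>\<^sub>M L. FI (\<lambda>z. \<psi> (snd z) * f z) z = \<psi> (snd z) * FI f z"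
proof -
  note FI_L2 = L2_bounded_opD(1)[OF tensor_id_bounded]
  note multM = L2_mult_Linf[OF L.Linf_snd[OF \<psi>, of M]]
  note multN = L2_mult_Linf[OF L.Linf_snd[OF \<psi>, of N]]
  obtain C where C: "0 \<le> C" "AE y in L. cmod (\<psi> y) \<le> C"
    using \<psi> by (rule LinfE)
  \<comment> \<open>The first factor \<open>K\<close> is arbitrary because multiplication is applied
    on both sides of the transform, over \<open>M\<close> and over \<open>N\<close>.\<close>
  have conv: "(\<lambda>n. L2_norm (K \<Otimes>\<^sub>M L) (\<lambda>z. \<psi> (snd z) * s n z - \<psi> (snd z) * f z)) \<longlonglongrightarrow> 0"
    if "\<And>n. s n \<in> L2 (K \<Otimes>\<^sub>M L)" "f \<in> L2 (K \<Otimes>\<^sub>M L)"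
      "(\<lambda>n. L2_norm (K \<Otimes>\<^sub>M L) (\<lambda>z. s n z - f z)) \<longlonglongrightarrow> 0" for K :: "'c measure" and s f
  proof (rule Lim_null_comparison)
    show "(\<lambda>n. C * L2_norm (K \<Otimes>\<^sub>M L) (\<lambda>z. s n z - f z)) \<longlonglongrightarrow> 0"
      using tendsto_mult_right_zero[OF that(3)] .
    have "(\<lambda>z. \<psi> (snd z)) \<in> borel_measurable (K \<Otimes>\<^sub>M L)"
      using L.Linf_snd[OF \<psi>, of K] by (simp add: Linf_def)
    then show "\<forall>\<^sub>F n in sequentially. norm (L2_norm (K \<Otimes>\<^sub>M L) (\<lambda>z. \<psi> (snd z) * s n z - \<psi> (snd z) * f z))
        \<le> C * L2_norm (K \<Otimes>\<^sub>M L) (\<lambda>z. s n z - f z)"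
      using L2_norm_mult_Linf_le[OF _ C(1) L.AE_pair_snd[OF C(2)] L2_diff[OF that(1,2)]]
      by (simp add: L2_norm_nonneg flip: right_diff_distrib)
  qed
  define D where "D = {f \<in> L2 (M \<Otimes>\<^sub>M L).
    AE z in N \<Otimes>\<^sub>M L. FI (\<lambda>z. \<psi> (snd z) * f z) z = \<psi> (snd z) * FI f z}"
  have D: "L2_closed_subspace (M \<Otimes>\<^sub>M L) D"
    unfolding L2_closed_subspace_def
  proof (intro conjI ballI allI impI)
    show "D \<subseteq> L2 (M \<Otimes>\<^sub>M L)"
      by (auto simp: D_def)
    have "AE z in N \<Otimes>\<^sub>M L. FI (\<lambda>z. 0) z = 0"
      using L2_bounded_opD(3)[OF tensor_id_bounded L2_zero, of 0] by simp
    then show "(\<lambda>z. 0) \<in> D"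
      by (auto simp: D_def L2_zero elim: eventually_mono)
  next
    fix f g assume f: "f \<in> D" and g: "g \<in> D"
    then have L2: "f \<in> L2 (M \<Otimes>\<^sub>M L)" "g \<in> L2 (M \<Otimes>\<^sub>M L)"
      by (auto simp: D_def)
    have "AE z in N \<Otimes>\<^sub>M L. FI (\<lambda>z. \<psi> (snd z) * f z) z = \<psi> (snd z) * FI f z"
      "AE z in N \<Otimes>\<^sub>M L. FI (\<lambda>z. \<psi> (snd z) * g z) z = \<psi> (snd z) * FI g z"
      using f g by (auto simp: D_def)
    with L2_bounded_opD(2)[OF tensor_id_bounded L2]
      L2_bounded_opD(2)[OF tensor_id_bounded multM[OF L2(1)] multM[OF L2(2)]]
    have "AE z in N \<Otimes>\<^sub>M L. FI (\<lambda>z. \<psi> (snd z) * (f z + g z)) z = \<psi> (snd z) * FI (\<lambda>z. f z + g z) z"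
      by eventually_elim (simp add: distrib_left)
    then show "(\<lambda>z. f z + g z) \<in> D"
      using L2 by (simp add: D_def L2_add)
  next
    fix c f assume f: "f \<in> D"
    then have L2: "f \<in> L2 (M \<Otimes>\<^sub>M L)"
      by (auto simp: D_def)
    have "AE z in N \<Otimes>\<^sub>M L. FI (\<lambda>z. \<psi> (snd z) * f z) z = \<psi> (snd z) * FI f z"
      using f by (auto simp: D_def)
    with L2_bounded_opD(3)[OF tensor_id_bounded L2, of c]
      L2_bounded_opD(3)[OF tensor_id_bounded multM[OF L2], of c]
    have "AE z in N \<Otimes>\<^sub>M L. FI (\<lambda>z. \<psi> (snd z) * (c * f z)) z = \<psi> (snd z) * FI (\<lambda>z. c * f z) z"
      by eventually_elim (simp add: mult.left_commute)
    then show "(\<lambda>z. c * f z) \<in> D"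
      using L2 by (simp add: D_def L2_scale)
  next
    fix s :: "nat \<Rightarrow> 'a \<times> 'y \<Rightarrow> complex" and f
    assume "\<forall>n. s n \<in> D" and f: "f \<in> L2 (M \<Otimes>\<^sub>M L)"
      and lim: "(\<lambda>n. L2_norm (M \<Otimes>\<^sub>M L) (\<lambda>z. s n z - f z)) \<longlonglongrightarrow> 0"
    then have s: "s n \<in> L2 (M \<Otimes>\<^sub>M L)"
      "AE z in N \<Otimes>\<^sub>M L. FI (\<lambda>z. \<psi> (snd z) * s n z) z = \<psi> (snd z) * FI (s n) z" for n
      by (auto simp: D_def)
    \<comment> \<open>Both functions are limits of the transforms of \<psi> s n: one multiplies
      before transforming, the other afterwards.\<close>
    have "AE z in N \<Otimes>\<^sub>M L. FI (\<lambda>z. \<psi> (snd z) * f z) z = \<psi> (snd z) * FI f z"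
    proof (rule L2_limit_unique)
      show "(\<lambda>n. L2_norm (N \<Otimes>\<^sub>M L) (\<lambda>z. FI (\<lambda>z. \<psi> (snd z) * s n z) z - FI (\<lambda>z. \<psi> (snd z) * f z) z)) \<longlonglongrightarrow> 0"
        by (rule L2_bounded_op_tendsto[OF tensor_id_bounded multM[OF s(1)] multM[OF f]
              conv[OF s(1) f lim]])
      have "L2_norm (N \<Otimes>\<^sub>M L) (\<lambda>z. FI (\<lambda>z. \<psi> (snd z) * s n z) z - \<psi> (snd z) * FI f z) =
          L2_norm (N \<Otimes>\<^sub>M L) (\<lambda>z. \<psi> (snd z) * FI (s n) z - \<psi> (snd z) * FI f z)" for n
        using s(2)[of n] by (intro L2_norm_cong_AE L2_diff FI_L2 multM multN s f) (auto elim: eventually_mono)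
      then show "(\<lambda>n. L2_norm (N \<Otimes>\<^sub>M L) (\<lambda>z. FI (\<lambda>z. \<psi> (snd z) * s n z) z - \<psi> (snd z) * FI f z)) \<longlonglongrightarrow> 0"
        using conv[OF FI_L2[OF s(1)] FI_L2[OF f]
            L2_bounded_op_tendsto[OF tensor_id_bounded s(1) f lim]] by simp
    qed (intro FI_L2 multM multN s f)+
    then show "f \<in> D"
      using f by (simp add: D_def)
  qed
  have "(\<lambda>(x, v). f x * g v) \<in> D" if f: "f \<in> L2 M" and g: "g \<in> L2 L" for f g
  proof -
    have "(\<lambda>z. \<psi> (snd z) * (case z of (x, v) \<Rightarrow> f x * g v)) = (\<lambda>(x, v). f x * (\<psi> v * g v))"
      by auto
    moreover note tensor_id_tensor[OF f L2_mult_Linf[OF \<psi> g]] tensor_id_tensor[OF f g]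
    ultimately have "AE z in N \<Otimes>\<^sub>M L. FI (\<lambda>z. \<psi> (snd z) * (case z of (x, v) \<Rightarrow> f x * g v)) z =
        \<psi> (snd z) * FI (\<lambda>(x, v). f x * g v) z"
      by (auto elim!: eventually_elim2)
    then show ?thesis
      using L.L2_tensor[OF f g] by (simp add: D_def)
  qed
  then have "D = L2 (M \<Otimes>\<^sub>M L)"
    by (rule L2_dense_tensor[OF M L D])
  then show ?thesis
    using f by (auto simp: D_def)
qed

end

section \<open>Translations\<close>

context
  fixes \<nu> :: "'g::topological_ab_group_add measure"
  assumes haar: "is_haar_measure euclidean (+) \<nu>"
begin

lemma sets_haar: "sets \<nu> = sets borel"
  using haar by (simp add: is_haar_measure_def borel_def)

lemma haar_sigma_finite:
  assumes "sigma_compact_space (euclidean :: 'g topology)" "metrizable_space (euclidean :: 'g topology)"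
  shows "sigma_finite_measure \<nu>"
proof -
  obtain K :: "nat \<Rightarrow> 'g set" where K: "\<And>n. compactin euclidean (K n)" "(\<Union>n. K n) = UNIV"
    using assms(1) by (auto simp: sigma_compact_space_def)
  \<comment> \<open>The type class carries no separation axiom; metrizability makes the space
    Hausdorff, so compact sets are closed and hence Borel.\<close>
  have "closed (K n)" for n
    using compactin_imp_closedin[OF metrizable_imp_Hausdorff_space[OF assms(2)] K(1)] by simp
  then have "K n \<in> sets \<nu>" for n
    by (simp add: sets_haar)
  moreover have "emeasure \<nu> (K n) < \<infinity>" for n
    using haar K(1) by (auto simp: is_haar_measure_def)
  moreover have "space \<nu> = UNIV"
    using sets_eq_imp_space_eq[OF sets_haar] by simp
  ultimately show ?thesis
    using K(2) by (intro sigma_finite_measure.intro exI[of _ "range K"]) (auto simp: less_top)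
qed

lemma translation_measurable: "(\<lambda>u. u - a) \<in> measurable \<nu> \<nu>"
proof -
  have "(\<lambda>u :: 'g. u - a) \<in> borel_measurable borel"
    by (intro borel_measurable_continuous_onI continuous_intros)
  then show ?thesis
    using measurable_cong_sets[OF sets_haar sets_haar] by blast
qed

lemma distr_haar: "distr \<nu> \<nu> (\<lambda>u. u - a) = \<nu>"
proof (rule measure_eqI)
  fix A assume "A \<in> sets (distr \<nu> \<nu> (\<lambda>u. u - a))"
  then have A: "A \<in> sets \<nu>"
    by simp
  have "(\<lambda>u. u - a) -` A \<inter> space \<nu> = (+) a ` A"
    using sets_eq_imp_space_eq[OF sets_haar] by (auto simp: image_iff algebra_simps) (metis diff_add_cancel)
  then show "emeasure (distr \<nu> \<nu> (\<lambda>u. u - a)) A = emeasure \<nu> A"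
    using haar A by (simp add: emeasure_distr translation_measurable is_haar_measure_def)
qed simp

context
  fixes L :: "'y measure"
  assumes L: "sigma_finite_measure L"
begin

lemma distr_haar_pair:
  "distr (\<nu> \<Otimes>\<^sub>M L) (\<nu> \<Otimes>\<^sub>M L) (\<lambda>(u, v). (u - a, v)) = \<nu> \<Otimes>\<^sub>M L"
  using pair_measure_distr[OF translation_measurable[of a] measurable_ident_sets[OF refl, of L]] L
  by (simp add: distr_haar)

lemma translation_pair_measurable:
  "(\<lambda>(u, v). (u - a, v)) \<in> measurable (\<nu> \<Otimes>\<^sub>M L) (\<nu> \<Otimes>\<^sub>M L)"
  unfolding case_prod_beta
  by (intro measurable_Pair measurable_snd measurable_compose[OF measurable_fst translation_measurable])

lemma integral_translation:
  fixes f :: "'g \<times> 'y \<Rightarrow> 'c::{banach, second_countable_topology}"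
  assumes "f \<in> borel_measurable (\<nu> \<Otimes>\<^sub>M L)"
  shows "(\<integral>z. f (fst z - a, snd z) \<partial>(\<nu> \<Otimes>\<^sub>M L)) = (\<integral>z. f z \<partial>(\<nu> \<Otimes>\<^sub>M L))"
  using integral_distr[OF translation_pair_measurable[of a] assms]
  by (simp add: distr_haar_pair case_prod_beta)

lemma translation_in_L2:
  assumes "f \<in> L2 (\<nu> \<Otimes>\<^sub>M L)"
  shows "translation a f \<in> L2 (\<nu> \<Otimes>\<^sub>M L)"
proof -
  have "translation a f = (\<lambda>z. f ((\<lambda>(u, v). (u - a, v)) z))"
    by (auto simp: translation_def)
  moreover have "integrable (\<nu> \<Otimes>\<^sub>M L) (\<lambda>z. (cmod (f ((\<lambda>(u, v). (u - a, v)) z)))\<^sup>2)"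
    using integrable_distr[OF translation_pair_measurable[of a], where f = "\<lambda>z. (cmod (f z))\<^sup>2"]
      L2_integrable_power[OF assms] by (simp add: distr_haar_pair)
  ultimately show ?thesis
    using measurable_compose[OF translation_pair_measurable L2_measurable[OF assms], of a]
    by (simp add: L2_def)
qed

lemma L2_inner_translation:
  assumes "f \<in> L2 (\<nu> \<Otimes>\<^sub>M L)" "h \<in> L2 (\<nu> \<Otimes>\<^sub>M L)"
  shows "L2_inner (\<nu> \<Otimes>\<^sub>M L) (translation a f) (translation a h) = L2_inner (\<nu> \<Otimes>\<^sub>M L) f h"
  using integral_translation[OF borel_measurable_integrable[OF integrable_L2_inner[OF assms]], of a]
  by (simp add: L2_inner_def translation_def case_prod_beta)

context
  fixes H P
  assumes H: "L2_closed_subspace (\<nu> \<Otimes>\<^sub>M L) H"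
    and invariant: "\<And>a f. f \<in> H \<Longrightarrow> translation a f \<in> H"
    and P: "is_L2_projection_onto (\<nu> \<Otimes>\<^sub>M L) H P"
begin

text \<open>Translations preserve inner products and \<open>H\<close> is invariant under their
  inverses too, so a test vector of \<open>H\<close> can be moved by -a to the other side and
  back.\<close>

lemma L2_projection_translation:
  assumes f: "f \<in> L2 (\<nu> \<Otimes>\<^sub>M L)"
  shows "AE z in \<nu> \<Otimes>\<^sub>M L. P (translation a f) z = translation a (P f) z"
proof (rule L2_projection_eqI[OF H P])
  show "translation a f \<in> L2 (\<nu> \<Otimes>\<^sub>M L)"
    using f by (rule translation_in_L2)
  show "translation a (P f) \<in> H"
    using f by (intro invariant L2_projection_in[OF H P])
  fix h assume h: "h \<in> H"
  have h': "translation (- a) h \<in> H"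
    using h by (rule invariant)
  then have L2: "translation (- a) h \<in> L2 (\<nu> \<Otimes>\<^sub>M L)"
    using L2_closed_subspaceD(1)[OF H] by blast
  have h_eq: "translation a (translation (- a) h) = h"
    by (auto simp: translation_def)
  have "L2_inner (\<nu> \<Otimes>\<^sub>M L) (translation a f) h = L2_inner (\<nu> \<Otimes>\<^sub>M L) f (translation (- a) h)"
    using L2_inner_translation[OF f L2, of a] by (simp add: h_eq)
  also have "\<dots> = L2_inner (\<nu> \<Otimes>\<^sub>M L) (P f) (translation (- a) h)"
    by (rule L2_projection_inner[OF H P f h', symmetric])
  also have "\<dots> = L2_inner (\<nu> \<Otimes>\<^sub>M L) (translation a (P f)) h"
    using L2_inner_translation[OF L2_projection_in_L2[OF H P f] L2, of a] by (simp add: h_eq)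
  finally show "L2_inner (\<nu> \<Otimes>\<^sub>M L) (translation a f) h =
      L2_inner (\<nu> \<Otimes>\<^sub>M L) (translation a (P f)) h" .
qed

text \<open>On \<open>H\<close> the compressed translation is the translation itself, almost
  everywhere. Multiplication by an invariant symbol and the projection both commute with
  translations.\<close>

lemma toeplitz_in_translation_commutant:
  assumes \<phi>: "\<phi> \<in> Linf (\<nu> \<Otimes>\<^sub>M L)" and \<phi>_inv: "\<And>a. translation a \<phi> = \<phi>"
  shows "toeplitz P \<phi> \<in> translation_commutant (\<nu> \<Otimes>\<^sub>M L) H P"
  unfolding translation_commutant_def L2_eq_def
proof (intro CollectI conjI allI ballI)
  show "L2_bounded_op (\<nu> \<Otimes>\<^sub>M L) H (\<nu> \<Otimes>\<^sub>M L) H (toeplitz P \<phi>)"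
    by (rule L2_bounded_op_toeplitz[OF H P \<phi>])
  fix a f assume f: "f \<in> H"
  have L2: "h \<in> L2 (\<nu> \<Otimes>\<^sub>M L)" if "h \<in> H" for h
    using that L2_closed_subspaceD(1)[OF H] by blast
  let ?g = "\<lambda>z. \<phi> z * f z"
  have g: "?g \<in> L2 (\<nu> \<Otimes>\<^sub>M L)"
    using \<phi> L2[OF f] by (rule L2_mult_Linf)
  have inv_eq: "\<phi> (u - a, v) = \<phi> (u, v)" for u v
    using fun_cong[OF \<phi>_inv[of a], of "(u, v)"] by (simp add: translation_def)
  have g_eq: "translation a ?g = (\<lambda>z. \<phi> z * translation a f z)"
    by (auto simp: translation_def inv_eq)
  have Tf: "P ?g \<in> H"
    by (rule L2_projection_in[OF H P g])
  have \<tau>f: "translation a f \<in> H"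
    using f by (rule invariant)
  \<comment> \<open>This removes the inner projection of the compression, which fixes the translate
    of f because it lies in \<open>H\<close>.\<close>
  have "AE z in \<nu> \<Otimes>\<^sub>M L. \<phi> z * P (translation a f) z = \<phi> z * translation a f z"
    using L2_projection_fixed[OF H P \<tau>f] by eventually_elim simp
  then have "AE z in \<nu> \<Otimes>\<^sub>M L. P (\<lambda>z. \<phi> z * P (translation a f) z) z = P (translation a ?g) z"
    unfolding g_eq
    by (intro L2_projection_cong[OF H P] L2_mult_Linf[OF \<phi>] L2_projection_in_L2[OF H P] L2[OF \<tau>f])
  moreover note L2_projection_translation[OF g, of a] L2_projection_fixed[OF H P invariant[OF Tf, of a]]
  ultimately show "AE z in \<nu> \<Otimes>\<^sub>M L. P (translation a (toeplitz P \<phi> f)) z =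
      toeplitz P \<phi> (P (translation a f)) z"
    unfolding toeplitz_def by eventually_elim simp
qed

end

end

end

section \<open>Fibres\<close>

lemma L2_closed_subspace_L2: "L2_closed_subspace M (L2 M)"
  by (auto simp: L2_closed_subspace_def L2_zero L2_add L2_scale)

text \<open>A unit vector of the range is some \<open>Q f\<close>, for which <Q f, f> = 1;
  conversely a nonzero \<open>Q f\<close> can be normalised. The right-hand side is the condition
  that can be checked measurably over the dual group.\<close>

lemma L2_range_projection_dim_pos_iff:
  assumes Q: "is_L2_projection L Q"
  shows "L2_dim L (L2_range L Q) > 0 \<longleftrightarrow> (\<exists>f\<in>L2 L. L2_inner L (Q f) f \<noteq> 0)"
proof -
  obtain K where K: "L2_closed_subspace L K" and QK: "is_L2_projection_onto L K Q"
    using Q by (auto simp: is_L2_projection_def)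
  note Q_L2 = L2_projection_in_L2[OF K QK]
  show ?thesis
  proof
    assume "L2_dim L (L2_range L Q) > 0"
    \<comment> \<open>The dimension is a supremum of cardinalities, so being positive means that
      some finite orthonormal set is nonempty.\<close>
    then obtain B where B: "0 < enat (card B)" "B \<subseteq> L2_range L Q"
      "\<forall>f\<in>B. \<forall>g\<in>B. L2_inner L f g = (if f = g then 1 else 0)"
      unfolding L2_dim_def less_Sup_iff by auto
    then obtain b where b: "b \<in> B"
      by (force simp: zero_enat_def)
    then obtain f where f: "b \<in> L2 L" "f \<in> L2 L" "AE x in L. b x = Q f x"
      using B(2) by (auto simp: L2_range_def L2_eq_def)
    have "L2_inner L (Q f) f = L2_inner L (Q f) (Q f)"
      using L2_projection_quadratic[OF K QK f(2)] by (simp add: L2_inner_self)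
    also have "\<dots> = L2_inner L b b"
      using f by (intro L2_inner_cong_AE[symmetric] Q_L2)
    also have "\<dots> = 1"
      using B(3) b by simp
    finally show "\<exists>f\<in>L2 L. L2_inner L (Q f) f \<noteq> 0"
      using f(2) by (intro bexI[of _ f]) auto
  next
    assume "\<exists>f\<in>L2 L. L2_inner L (Q f) f \<noteq> 0"
    then obtain f where f: "f \<in> L2 L" "L2_inner L (Q f) f \<noteq> 0"
      by blast
    define n where "n = L2_norm L (Q f)"
    have n: "n \<noteq> 0"
      using f L2_projection_quadratic[OF K QK f(1)] by (auto simp: n_def)
    define e where "e = (\<lambda>x. inverse (of_real n) * Q f x)"
    have "e \<in> L2_range L Q"
    proof -
      have "AE x in L. e x = Q (\<lambda>x. inverse (of_real n) * f x) x"
        using L2_projection_scale[OF K QK f(1), of "inverse (of_real n)"]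
        by eventually_elim (simp add: e_def)
      then show ?thesis
        using L2_scale[OF f(1)] L2_scale[OF Q_L2[OF f(1)]]
        by (auto simp: L2_range_def L2_eq_def e_def)
    qed
    moreover have "L2_inner L e e = 1"
      unfolding e_def L2_inner_scale_left L2_inner_scale_right L2_inner_self n_def[symmetric]
      using n by (simp add: power2_eq_square field_simps)
    ultimately have "enat (card {e}) \<le> L2_dim L (L2_range L Q)"
      unfolding L2_dim_def by (intro Sup_upper CollectI exI[of _ "{e}"]) auto
    moreover have "0 < enat (card {e})"
      by (simp add: zero_enat_def)
    ultimately show "L2_dim L (L2_range L Q) > 0"
      by (rule order.strict_trans2[rotated])
  qed
qed

lemma L2_range_projection_trivial:
  assumes Q: "is_L2_projection L Q" and dim: "\<not> L2_dim L (L2_range L Q) > 0"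
    and g: "g \<in> L2_range L Q"
  shows "AE x in L. g x = 0"
proof -
  obtain K where K: "L2_closed_subspace L K" and QK: "is_L2_projection_onto L K Q"
    using Q by (auto simp: is_L2_projection_def)
  obtain f where f: "f \<in> L2 L" "AE x in L. g x = Q f x"
    using g by (auto simp: L2_range_def L2_eq_def)
  have "L2_inner L (Q f) f = 0"
    using dim f(1) unfolding L2_range_projection_dim_pos_iff[OF Q] by blast
  then have "AE x in L. Q f x = 0"
    using L2_projection_quadratic[OF K QK f(1)] L2_norm_eq_0_iff[OF L2_projection_in_L2[OF K QK f(1)]]
    by simp
  with f(2) show ?thesis
    by eventually_elim simp
qed

text \<open>Normalisation of q recovers the unspecified scalar as an inner product, the same
  integral that defines \<open>R_op\<close> on a fibre.\<close>

lemma L2_span1_coefficient: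
  assumes "q \<in> L2 L" "L2_norm L q = 1" "g \<in> L2_span1 L q"
  shows "AE x in L. g x = L2_inner L g q * q x"
proof -
  obtain c where c: "AE x in L. g x = c * q x" and g: "g \<in> L2 L"
    using assms(3) by (auto simp: L2_span1_def L2_eq_def)
  have "L2_inner L g q = L2_inner L (\<lambda>x. c * q x) q"
    using c g assms(1) by (intro L2_inner_cong_AE L2_scale) auto
  also have "\<dots> = c"
    using assms(2) by (simp add: L2_inner_scale_left L2_inner_self)
  finally show ?thesis
    using c by simp
qed

text \<open>If \<open>Q\<close> killed a vector d closer to f than the norm of \<open>Q f\<close>,
  the contraction property would give \<open>Q f\<close> a norm smaller than itself. This replaces
  an uncountable union by a countable one.\<close>

lemma L2_projection_nonzero_on_dense:
  assumes Q: "is_L2_projection L Q"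
    and D: "D \<subseteq> L2 L" "\<And>f e. f \<in> L2 L \<Longrightarrow> 0 < e \<Longrightarrow> \<exists>d\<in>D. L2_norm L (\<lambda>x. f x - d x) < e"
  shows "(\<exists>f\<in>L2 L. L2_inner L (Q f) f \<noteq> 0) \<longleftrightarrow> (\<exists>d\<in>D. L2_inner L (Q d) d \<noteq> 0)"
proof
  obtain K where K: "L2_closed_subspace L K" and QK: "is_L2_projection_onto L K Q"
    using Q by (auto simp: is_L2_projection_def)
  note Q_L2 = L2_projection_in_L2[OF K QK]
  assume "\<exists>f\<in>L2 L. L2_inner L (Q f) f \<noteq> 0"
  then obtain f where f: "f \<in> L2 L" "L2_norm L (Q f) \<noteq> 0"
    using L2_projection_quadratic[OF K QK] by fastforce
  then have "0 < L2_norm L (Q f)"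
    using L2_norm_nonneg[of L "Q f"] by linarith
  then obtain d where d: "d \<in> D" "L2_norm L (\<lambda>x. f x - d x) < L2_norm L (Q f)"
    using D(2)[OF f(1)] by blast
  have dL2: "d \<in> L2 L"
    using d(1) D(1) by blast
  have "AE x in L. Q f x = Q (\<lambda>x. f x - d x) x + Q d x"
    using L2_projection_add[OF K QK L2_diff[OF f(1) dL2] dL2] by simp
  then have "L2_norm L (Q f) = L2_norm L (\<lambda>x. Q (\<lambda>x. f x - d x) x + Q d x)"
    by (intro L2_norm_cong_AE L2_add Q_L2 L2_diff f(1) dL2)
  also have "\<dots> \<le> L2_norm L (Q (\<lambda>x. f x - d x)) + L2_norm L (Q d)"
    by (intro L2_norm_triangle Q_L2 L2_diff f(1) dL2)
  also have "\<dots> \<le> L2_norm L (\<lambda>x. f x - d x) + L2_norm L (Q d)"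
    using L2_projection_norm_le[OF K QK L2_diff[OF f(1) dL2]] by simp
  finally have "L2_norm L (Q d) \<noteq> 0"
    using d(2) by linarith
  then have "L2_inner L (Q d) d \<noteq> 0"
    by (simp add: L2_projection_quadratic[OF K QK dL2])
  then show "\<exists>d\<in>D. L2_inner L (Q d) d \<noteq> 0"
    using d(1) by blast
qed (use D(1) in blast)

section \<open>The dual group as a measurable space, and measurability of
  \<open>Omega\<close>\<close>

lemma space_dual_haar:
  assumes "is_haar_measure dual_topology m N"
  shows "space N = dual_group"
proof -
  have "\<Union>{{\<xi> \<in> dual_group. \<xi> ` K \<subseteq> U} | K U. compact K \<and> open U} = dual_group"
    \<comment> \<open>The empty compact set imposes no condition, so the whole dual group is itself
      a generating open set.\<close>
    by (auto intro!: exI[of _ "{}"])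
  then show ?thesis
    using assms by (simp add: is_haar_measure_def dual_topology_def topology_generated_by_topspace)
qed

lemma sets_Omega:
  assumes space: "space N = dual_group" and sep: "L2_separable L"
    and Q: "\<And>\<xi>. \<xi> \<in> dual_group \<Longrightarrow> is_L2_projection L (Q \<xi>)"
    and meas: "\<And>g h. g \<in> L2 L \<Longrightarrow> h \<in> L2 L \<Longrightarrow> (\<lambda>\<xi>. L2_inner L (Q \<xi> g) h) \<in> borel_measurable N"
  shows "Omega L Q \<in> sets N"
proof -
  obtain D where D: "countable D" "D \<subseteq> L2 L"
    "\<And>f e. f \<in> L2 L \<Longrightarrow> 0 < e \<Longrightarrow> \<exists>d\<in>D. L2_norm L (\<lambda>x. f x - d x) < e"
    using sep unfolding L2_separable_def by blast
  have "L2_dim L (L2_range L (Q \<xi>)) > 0 \<longleftrightarrow> (\<exists>d\<in>D. L2_inner L (Q \<xi> d) d \<noteq> 0)"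
    if "\<xi> \<in> dual_group" for \<xi>
    unfolding L2_range_projection_dim_pos_iff[OF Q[OF that]]
    by (rule L2_projection_nonzero_on_dense[OF Q[OF that] D(2,3)])
  then have "Omega L Q = (\<Union>d\<in>D. {\<xi> \<in> space N. L2_inner L (Q \<xi> d) d \<noteq> 0})"
    unfolding Omega_def fiber_dim_def space by blast
  also have "\<dots> \<in> sets N"
  proof (rule sets.countable_UN''[OF D(1)])
    fix d assume "d \<in> D"
    then have [measurable]: "(\<lambda>\<xi>. L2_inner L (Q \<xi> d) d) \<in> borel_measurable N"
      using D(2) by (intro meas) auto
    show "{\<xi> \<in> space N. L2_inner L (Q \<xi> d) d \<noteq> 0} \<in> sets N"
      by measurable
  qed
  finally show ?thesis .
qed

text \<open>A candidate h shows that the choice in \<open>L2_adjoint\<close> is not vacuous; any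
  chosen value has the same inner products with \<open>H\<close> as h.\<close>

lemma L2_adjoint_eqI:
  assumes H: "L2_closed_subspace M H" and h: "h \<in> H"
    and eq: "\<And>f. f \<in> H \<Longrightarrow> L2_inner N (S f) g = L2_inner M f h"
  shows "L2_adjoint M H N S g \<in> H" and "AE x in M. L2_adjoint M H N S g x = h x"
proof -
  let ?A = "L2_adjoint M H N S g"
  have "?A \<in> H \<and> (\<forall>f\<in>H. L2_inner N (S f) g = L2_inner M f ?A)"
    unfolding L2_adjoint_def by (rule someI[of _ h]) (use h eq in blast)
  then have A: "?A \<in> H" "\<And>f. f \<in> H \<Longrightarrow> L2_inner M f ?A = L2_inner M f h"
    using eq by auto
  show "?A \<in> H"
    by (rule A)
  show "AE x in M. ?A x = h x"
    by (rule L2_subspace_inner_unique[OF H A(1) h])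
      (simp add: A(2) L2_inner_commute[of M ?A] L2_inner_commute[of M h])
qed

text \<open>The adjoint of \<open>S\<close> undoes \<open>S\<close>, and \<open>P\<close> fixes f,
  so the conjugated projection fixes \<open>S f\<close>. Decomposed over \<open>N\<close>, this says
  that almost every fibre of \<open>S f\<close> is fixed by \<open>Q \<xi>\<close>.\<close>

lemma direct_integral_fibre_in_range:
  assumes L: "sigma_finite_measure L"
    and H: "L2_closed_subspace M H" and P: "is_L2_projection_onto M H P"
    and S: "L2_bounded_op M (L2 M) (N \<Otimes>\<^sub>M L) (L2 (N \<Otimes>\<^sub>M L)) S"
    and inner: "\<And>f g. f \<in> L2 M \<Longrightarrow> g \<in> L2 M \<Longrightarrow>
      L2_inner (N \<Otimes>\<^sub>M L) (S f) (S g) = L2_inner M f g"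
    and Q: "is_direct_integral N L (conjugate_projection M (N \<Otimes>\<^sub>M L) S P) Q"
    and f: "f \<in> H"
  shows "AE \<xi> in N. (\<lambda>v. S f (\<xi>, v)) \<in> L2_range L (Q \<xi>)"
proof -
  interpret L: sigma_finite_measure L by fact
  have fL2: "f \<in> L2 M"
    using f L2_closed_subspaceD(1)[OF H] by blast
  note SfL2 = L2_bounded_opD(1)[OF S fL2]
  \<comment> \<open>The adjoint is a choice, so g is only almost everywhere equal to f; the
    difference must be carried through \<open>P\<close> and \<open>S\<close>.\<close>
  define g where "g = L2_adjoint M (L2 M) (N \<Otimes>\<^sub>M L) S (S f)"
  have g: "g \<in> L2 M" "AE x in M. g x = f x"
    unfolding g_def
    by (rule L2_adjoint_eqI[OF L2_closed_subspace_L2 fL2 inner[OF _ fL2]]; assumption)+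
  have "AE x in M. P g x = P f x"
    by (intro L2_projection_cong[OF H P g(1) fL2 g(2)])
  with L2_projection_fixed[OF H P f] have "AE x in M. P g x = f x"
    by eventually_elim simp
  then have "AE z in N \<Otimes>\<^sub>M L. S (P g) z = S f z"
    using g fL2 by (intro L2_bounded_op_cong[OF S] L2_projection_in_L2[OF H P]) auto
  then have "AE \<xi> in N. AE v in L. S (P g) (\<xi>, v) = S f (\<xi>, v)"
    by (rule L.AE_pair_fst)
  moreover have "AE \<xi> in N. AE v in L. S (P g) (\<xi>, v) = Q \<xi> (\<lambda>v. S f (\<xi>, v)) v"
    using Q SfL2 by (simp add: is_direct_integral_def conjugate_projection_def L2_eq_def g_def)
  moreover note L.AE_L2_fst[OF SfL2]
  ultimately show ?thesis
  proof eventually_elim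
    case (elim \<xi>)
    from elim(1,2) have "AE v in L. S f (\<xi>, v) = Q \<xi> (\<lambda>v. S f (\<xi>, v)) v"
      by eventually_elim simp
    then show ?case
      using elim(3) by (auto simp: L2_range_def L2_eq_def)
  qed
qed

section \<open>The symbol \<gamma> and the transform R on fibres\<close>

lemma gamma_fun_eq_inner: "gamma_fun L q \<psi> \<xi> = L2_inner L (\<lambda>v. \<psi> v * q \<xi> v) (q \<xi>)"
  by (simp add: gamma_fun_def L2_inner_def mult.assoc complex_norm_square del: of_real_power)

text \<open>As q is normalised, Cauchy-Schwarz bounds the symbol everywhere on the space by an
  essential bound of \<psi>.\<close>

lemma gamma_fun_Linf:
  assumes L: "sigma_finite_measure L"
    and q: "\<And>\<xi>. \<xi> \<in> space N \<Longrightarrow> q \<xi> \<in> L2 L" "\<And>\<xi>. \<xi> \<in> space N \<Longrightarrow> L2_norm L (q \<xi>) = 1"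
    and meas: "(\<lambda>(\<xi>, v). q \<xi> v) \<in> borel_measurable (N \<Otimes>\<^sub>M L)"
    and \<psi>: "\<psi> \<in> Linf L"
  shows "gamma_fun L q \<psi> \<in> Linf N"
proof -
  interpret L: sigma_finite_measure L by fact
  note [measurable] = meas
  have \<psi>_meas [measurable]: "\<psi> \<in> borel_measurable L"
    using \<psi> by (simp add: Linf_def)
  obtain C where C: "0 \<le> C" "AE v in L. cmod (\<psi> v) \<le> C"
    using \<psi> by (rule LinfE)
  have "gamma_fun L q \<psi> \<in> borel_measurable N"
    unfolding gamma_fun_def[abs_def] by measurable
  moreover have "cmod (gamma_fun L q \<psi> \<xi>) \<le> C" if \<xi>: "\<xi> \<in> space N" for \<xi>
    using L2_Cauchy_Schwarz[OF L2_mult_Linf[OF \<psi> q(1)[OF \<xi>]] q(1)[OF \<xi>]]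
      L2_norm_mult_Linf_le[OF \<psi>_meas C q(1)[OF \<xi>]] q(2)[OF \<xi>]
    by (simp add: gamma_fun_eq_inner)
  ultimately show ?thesis
    unfolding Linf_def by (auto intro!: exI[of _ C] AE_I2)
qed

lemma R_op_measurable:
  assumes L: "sigma_finite_measure L"
    and q: "(\<lambda>(\<xi>, v). q \<xi> v) \<in> borel_measurable (restrict_space N \<Omega> \<Otimes>\<^sub>M L)"
    and f: "FI f \<in> borel_measurable (N \<Otimes>\<^sub>M L)"
  shows "R_op L FI q f \<in> borel_measurable (restrict_space N \<Omega>)"
proof -
  interpret L: sigma_finite_measure L by fact
  \<comment> \<open>q is measurable only over \<Omega>, so \<open>FI f\<close> is pulled back along
    the inclusion before the two are multiplied.\<close>
  have "(\<lambda>z. z) \<in> measurable (restrict_space N \<Omega> \<Otimes>\<^sub>M L) (N \<Otimes>\<^sub>M L)"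
    unfolding measurable_pair_iff o_def
    by (intro conjI measurable_snd measurable_compose[OF measurable_fst measurable_restrict_space1])
      simp
  from measurable_compose[OF this f] q [measurable]
  have [measurable]: "FI f \<in> borel_measurable (restrict_space N \<Omega> \<Otimes>\<^sub>M L)"
    by simp
  show ?thesis
    unfolding R_op_def[abs_def] by measurable
qed

text \<open>Over \<Omega> both fibres are multiples of q, with coefficients R k and R f, so the
  fibre inner product is R k times the conjugate of R f times <q, \<psi> q>, and the last factor is
  the conjugate of \<gamma>.\<close>

lemma L2_inner_line_fibres:
  assumes L: "sigma_finite_measure L" and \<Omega>: "\<Omega> \<in> sets N"
    and q: "\<And>\<xi>. \<xi> \<in> \<Omega> \<Longrightarrow> q \<xi> \<in> L2 L" "\<And>\<xi>. \<xi> \<in> \<Omega> \<Longrightarrow> L2_norm L (q \<xi>) = 1"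
    and meas: "(\<lambda>(\<xi>, v). q \<xi> v) \<in> borel_measurable (restrict_space N \<Omega> \<Otimes>\<^sub>M L)"
    and \<psi>: "\<psi> \<in> Linf L"
    and k: "FI k \<in> L2 (N \<Otimes>\<^sub>M L)" and f: "FI f \<in> L2 (N \<Otimes>\<^sub>M L)"
    and k_line: "AE \<xi> in N. \<xi> \<in> \<Omega> \<longrightarrow> (\<lambda>v. FI k (\<xi>, v)) \<in> L2_span1 L (q \<xi>)"
    and f_line: "AE \<xi> in N. \<xi> \<in> \<Omega> \<longrightarrow> (\<lambda>v. FI f (\<xi>, v)) \<in> L2_span1 L (q \<xi>)"
    and k_zero: "AE \<xi> in N. \<xi> \<notin> \<Omega> \<longrightarrow> (AE v in L. FI k (\<xi>, v) = 0)"
  shows "L2_inner (N \<Otimes>\<^sub>M L) (FI k) (\<lambda>z. \<psi> (snd z) * FI f z) =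
    L2_inner (restrict_space N \<Omega>) (R_op L FI q k) (\<lambda>\<xi>. gamma_fun L q \<psi> \<xi> * R_op L FI q f \<xi>)"
proof -
  interpret L: sigma_finite_measure L by fact
  let ?R = "R_op L FI q" and ?\<gamma> = "gamma_fun L q \<psi>"
  have \<Omega>_space: "\<Omega> \<inter> space N \<in> sets N" and space_\<Omega>: "space (restrict_space N \<Omega>) = \<Omega>"
    using \<Omega> sets.sets_into_space[OF \<Omega>] by (auto simp: Int_absorb2 space_restrict_space)
  have R_eq: "?R h \<xi> = L2_inner L (\<lambda>v. FI h (\<xi>, v)) (q \<xi>)" for h \<xi>
    by (simp add: R_op_def L2_inner_def)
  have [measurable]: "?R k \<in> borel_measurable (restrict_space N \<Omega>)"
    "?R f \<in> borel_measurable (restrict_space N \<Omega>)"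
    by (rule R_op_measurable[OF L meas], rule L2_measurable, fact)+
  have [measurable]: "?\<gamma> \<in> borel_measurable (restrict_space N \<Omega>)"
    using gamma_fun_Linf[OF L _ _ meas \<psi>] q unfolding space_\<Omega> Linf_def by blast
  have \<psi>f: "(\<lambda>z. \<psi> (snd z) * FI f z) \<in> L2 (N \<Otimes>\<^sub>M L)"
    by (rule L2_mult_Linf[OF L.Linf_snd[OF \<psi>] f])
  have [measurable]: "FI k \<in> borel_measurable (N \<Otimes>\<^sub>M L)"
    "(\<lambda>z. \<psi> (snd z) * FI f z) \<in> borel_measurable (N \<Otimes>\<^sub>M L)"
    using k \<psi>f by (auto intro: L2_measurable)
  have "L2_inner (N \<Otimes>\<^sub>M L) (FI k) (\<lambda>z. \<psi> (snd z) * FI f z) =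
      (\<integral>\<xi>. L2_inner L (\<lambda>v. FI k (\<xi>, v)) (\<lambda>v. \<psi> v * FI f (\<xi>, v)) \<partial>N)"
    using L.integral_pair_fst[OF integrable_L2_inner[OF k \<psi>f]] by (simp add: L2_inner_def)
  \<comment> \<open>The fibres of \<open>FI k\<close> vanish off \<Omega>; the indicator also
    suppresses the arbitrary values of q there.\<close>
  also have "\<dots> = (\<integral>\<xi>. indicator \<Omega> \<xi> *\<^sub>R (?R k \<xi> * cnj (?\<gamma> \<xi> * ?R f \<xi>)) \<partial>N)"
  proof (rule integral_cong_AE)
    show "(\<lambda>\<xi>. L2_inner L (\<lambda>v. FI k (\<xi>, v)) (\<lambda>v. \<psi> v * FI f (\<xi>, v))) \<in> borel_measurable N"
      unfolding L2_inner_def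
      using borel_measurable_integrable[OF integrable_L2_inner[OF k \<psi>f]]
      by (intro L.borel_measurable_lebesgue_integral) (simp only: case_prod_beta' prod.collapse)
    show "(\<lambda>\<xi>. indicator \<Omega> \<xi> *\<^sub>R (?R k \<xi> * cnj (?\<gamma> \<xi> * ?R f \<xi>))) \<in> borel_measurable N"
      \<comment> \<open>Measurability of a function cut off by the indicator is equivalent to
        measurability on \<Omega>, where q is controlled.\<close>
      by (subst borel_measurable_restrict_space_iff[OF \<Omega>_space, symmetric]) measurable
    show "AE \<xi> in N. L2_inner L (\<lambda>v. FI k (\<xi>, v)) (\<lambda>v. \<psi> v * FI f (\<xi>, v)) =
        indicator \<Omega> \<xi> *\<^sub>R (?R k \<xi> * cnj (?\<gamma> \<xi> * ?R f \<xi>))"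
      using L.AE_L2_fst[OF k] L.AE_L2_fst[OF f] k_line f_line k_zero
    proof eventually_elim
      case (elim \<xi>)
      have \<psi>f\<xi>: "(\<lambda>v. \<psi> v * FI f (\<xi>, v)) \<in> L2 L"
        using \<psi> elim(2) by (rule L2_mult_Linf)
      show ?case
      proof (cases "\<xi> \<in> \<Omega>")
        case True
        have k_eq: "AE v in L. FI k (\<xi>, v) = ?R k \<xi> * q \<xi> v"
          unfolding R_eq using elim(3) True by (intro L2_span1_coefficient q) auto
        have "AE v in L. FI f (\<xi>, v) = ?R f \<xi> * q \<xi> v"
          unfolding R_eq using elim(4) True by (intro L2_span1_coefficient q) auto
        then have f_eq: "AE v in L. \<psi> v * FI f (\<xi>, v) = ?R f \<xi> * (\<psi> v * q \<xi> v)"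
          by eventually_elim simp
        have "L2_inner L (\<lambda>v. FI k (\<xi>, v)) (\<lambda>v. \<psi> v * FI f (\<xi>, v)) =
            L2_inner L (\<lambda>v. ?R k \<xi> * q \<xi> v) (\<lambda>v. ?R f \<xi> * (\<psi> v * q \<xi> v))"
          by (intro L2_inner_cong_AE elim(1) \<psi>f\<xi> L2_scale L2_mult_Linf[OF \<psi>] q True k_eq f_eq)
        also have "\<dots> = ?R k \<xi> * cnj (?\<gamma> \<xi> * ?R f \<xi>)"
          using L2_inner_commute[of L "q \<xi>" "\<lambda>v. \<psi> v * q \<xi> v"]
          by (simp add: L2_inner_scale_left L2_inner_scale_right gamma_fun_eq_inner)
        finally show ?thesis
          using True by simp
      next
        case False
        then have "L2_inner L (\<lambda>v. FI k (\<xi>, v)) (\<lambda>v. \<psi> v * FI f (\<xi>, v)) =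
            L2_inner L (\<lambda>v. 0) (\<lambda>v. \<psi> v * FI f (\<xi>, v))"
          using elim(5) by (intro L2_inner_cong_AE elim(1) \<psi>f\<xi> L2_zero) auto
        then show ?thesis
          using False by (simp add: L2_inner_def)
      qed
    qed
  qed
  also have "\<dots> = L2_inner (restrict_space N \<Omega>) (?R k) (\<lambda>\<xi>. ?\<gamma> \<xi> * ?R f \<xi>)"
    by (simp add: L2_inner_def integral_restrict_space[OF \<Omega>_space])
  finally show ?thesis .
qed

text \<open>Against \<open>H\<close> the projection of \<phi> f has the same inner products as
  \<phi> f, so the Toeplitz value is itself the witness for the adjoint at g.\<close>

lemma toeplitz_eq_L2_adjoint:
  assumes H: "L2_closed_subspace M H" and P: "is_L2_projection_onto M H P"
    and \<phi>f: "(\<lambda>x. \<phi> x * f x) \<in> L2 M"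
    and eq: "\<And>k. k \<in> H \<Longrightarrow> L2_inner M k (\<lambda>x. \<phi> x * f x) = L2_inner N (R k) g"
  shows "L2_eq M (toeplitz P \<phi> f) (L2_adjoint M H N R g)"
proof -
  have T: "toeplitz P \<phi> f \<in> H"
    unfolding toeplitz_def by (rule L2_projection_in[OF H P \<phi>f])
  have T_inner: "L2_inner M k (toeplitz P \<phi> f) = L2_inner N (R k) g" if "k \<in> H" for k
    unfolding toeplitz_def eq[OF that, symmetric]
    by (metis L2_inner_commute L2_projection_inner[OF H P \<phi>f that])
  show ?thesis
    using L2_adjoint_eqI(2)[OF H T T_inner[symmetric]] by (auto simp: L2_eq_def elim: eventually_mono)
qed

theorem proposition7p11:
  fixes \<nu> :: "'g::topological_ab_group_add measure"
    and \<nu>' :: "('g \<Rightarrow> complex) measure"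
    and lam :: "'y measure"
    and F :: "('g \<Rightarrow> complex) \<Rightarrow> (('g \<Rightarrow> complex) \<Rightarrow> complex)"
    and FI :: "('g \<times> 'y \<Rightarrow> complex) \<Rightarrow> (('g \<Rightarrow> complex) \<times> 'y \<Rightarrow> complex)"
    and H :: "('g \<times> 'y \<Rightarrow> complex) set"
    and P :: "('g \<times> 'y \<Rightarrow> complex) \<Rightarrow> ('g \<times> 'y \<Rightarrow> complex)"
    and Phat :: "('g \<Rightarrow> complex) \<Rightarrow> ('y \<Rightarrow> complex) \<Rightarrow> ('y \<Rightarrow> complex)"
    and q :: "('g \<Rightarrow> complex) \<Rightarrow> 'y \<Rightarrow> complex"
    and \<psi> :: "'y \<Rightarrow> complex"
    and \<phi> :: "'g \<times> 'y \<Rightarrow> complex"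
  assumes G_locally_compact: "locally_compact_space (euclidean :: 'g topology)"
    and G_sigma_compact: "sigma_compact_space (euclidean :: 'g topology)"
    and G_metrizable: "metrizable_space (euclidean :: 'g topology)"
    and haar: "is_haar_measure euclidean (+) \<nu>"
    and dual_haar: "is_dual_haar_measure \<nu> \<nu>'"
    and Y_sigma_finite: "sigma_finite_measure lam"
    and L2_G_separable: "L2_separable \<nu>"
    and L2_Y_separable: "L2_separable lam"
    and fourier: "is_L2_fourier \<nu> \<nu>' F"
    and fourier_tensor: "is_tensor_id \<nu> \<nu>' lam F FI"
    and H_closed: "L2_closed_subspace (\<nu> \<Otimes>\<^sub>M lam) H"
    and H_invariant: "\<And>a f. f \<in> H \<Longrightarrow> translation a f \<in> H"
    and P_projection: "is_L2_projection_onto (\<nu> \<Otimes>\<^sub>M lam) H P"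
    and Phat_projection: "\<And>\<xi>. \<xi> \<in> dual_group \<Longrightarrow> is_L2_projection lam (Phat \<xi>)"
    and Phat_decomposition:
      "is_direct_integral \<nu>' lam
         (conjugate_projection (\<nu> \<Otimes>\<^sub>M lam) (\<nu>' \<Otimes>\<^sub>M lam) FI P) Phat"
    and dim_one: "\<And>\<xi>. \<xi> \<in> Omega lam Phat \<Longrightarrow> fiber_dim lam Phat \<xi> = 1"
    and q_L2: "\<And>\<xi>. \<xi> \<in> Omega lam Phat \<Longrightarrow> q \<xi> \<in> L2 lam"
    and q_spans: "\<And>\<xi>. \<xi> \<in> Omega lam Phat \<Longrightarrow> L2_range lam (Phat \<xi>) = L2_span1 lam (q \<xi>)"
    and q_norm: "\<And>\<xi>. \<xi> \<in> Omega lam Phat \<Longrightarrow> L2_norm lam (q \<xi>) = 1"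
    and q_measurable:
      "(\<lambda>(\<xi>, v). q \<xi> v) \<in>
         borel_measurable (restrict_space \<nu>' (Omega lam Phat) \<Otimes>\<^sub>M lam)"
    and psi: "\<psi> \<in> Linf lam"
    and phi: "\<And>u v. \<phi> (u, v) = \<psi> v"
  shows "\<phi> \<in> Linf (\<nu> \<Otimes>\<^sub>M lam) \<and>
         toeplitz P \<phi> \<in> translation_commutant (\<nu> \<Otimes>\<^sub>M lam) H P \<and>
         gamma_fun lam q \<psi> \<in> Linf (restrict_space \<nu>' (Omega lam Phat)) \<and>
         (\<forall>f\<in>H. L2_eq (\<nu> \<Otimes>\<^sub>M lam)
           (toeplitz P \<phi> f)
           (Lambda_op (\<nu> \<Otimes>\<^sub>M lam) H (restrict_space \<nu>' (Omega lam Phat))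
              (R_op lam FI q) (gamma_fun lam q \<psi>) f))"
proof -
  interpret lam: sigma_finite_measure lam by (rule Y_sigma_finite)
  let ?M = "\<nu> \<Otimes>\<^sub>M lam" and ?N = "\<nu>' \<Otimes>\<^sub>M lam" and ?\<Omega> = "Omega lam Phat"
  have nu: "sigma_finite_measure \<nu>"
    using haar G_sigma_compact G_metrizable by (rule haar_sigma_finite)
  have F: "L2_unitary \<nu> (L2 \<nu>) \<nu>' (L2 \<nu>') F"
    using fourier by (simp add: is_L2_fourier_def)
  note FI_bounded = tensor_id_bounded[OF nu Y_sigma_finite F fourier_tensor]
  note FI_inner = tensor_id_inner[OF nu Y_sigma_finite F fourier_tensor]
  note FI_L2 = L2_bounded_opD(1)[OF FI_bounded]
  have H_L2: "f \<in> L2 ?M" if "f \<in> H" for f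
    using that L2_closed_subspaceD(1)[OF H_closed] by blast
  have space: "space \<nu>' = dual_group"
    using dual_haar unfolding is_dual_haar_measure_def by (intro space_dual_haar) (rule conjunct1)
  have \<Omega>: "?\<Omega> \<in> sets \<nu>'"
    using space L2_Y_separable Phat_projection Phat_decomposition
    by (intro sets_Omega) (auto simp: is_direct_integral_def)
  have space_\<Omega>: "space (restrict_space \<nu>' ?\<Omega>) = ?\<Omega>"
    using sets.sets_into_space[OF \<Omega>] by (auto simp: space_restrict_space)
  have \<phi>_eq: "\<phi> = (\<lambda>z. \<psi> (snd z))"
    by (simp add: fun_eq_iff phi)
  have \<phi>: "\<phi> \<in> Linf ?M"
    unfolding \<phi>_eq by (rule lam.Linf_snd[OF psi])
  have commutant: "toeplitz P \<phi> \<in> translation_commutant ?M H P"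
    by (rule toeplitz_in_translation_commutant
        [OF haar Y_sigma_finite H_closed H_invariant P_projection \<phi>])
      (auto simp: translation_def phi)
  have gamma: "gamma_fun lam q \<psi> \<in> Linf (restrict_space \<nu>' ?\<Omega>)"
    by (rule gamma_fun_Linf[OF Y_sigma_finite _ _ q_measurable psi]) (auto simp: space_\<Omega> q_L2 q_norm)
  have fibre: "AE \<xi> in \<nu>'. (\<lambda>v. FI f (\<xi>, v)) \<in> L2_range lam (Phat \<xi>)" if "f \<in> H" for f
    by (rule direct_integral_fibre_in_range[OF Y_sigma_finite H_closed P_projection FI_bounded
          FI_inner Phat_decomposition that])
  have line: "AE \<xi> in \<nu>'. \<xi> \<in> ?\<Omega> \<longrightarrow> (\<lambda>v. FI f (\<xi>, v)) \<in> L2_span1 lam (q \<xi>)" if "f \<in> H" for f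
    using fibre[OF that] by eventually_elim (use q_spans in blast)
  have zero: "AE \<xi> in \<nu>'. \<xi> \<notin> ?\<Omega> \<longrightarrow> (AE v in lam. FI f (\<xi>, v) = 0)" if "f \<in> H" for f
    \<comment> \<open>\<open>AE_space\<close> places \<xi> in the dual group: there
      \<open>Phat \<xi>\<close> is a projection, and lying outside \<open>Omega\<close> means that
      the fibre dimension is not positive.\<close>
    using fibre[OF that] AE_space
  proof eventually_elim
    case (elim \<xi>)
    show ?case
    proof
      assume "\<xi> \<notin> ?\<Omega>"
      then show "AE v in lam. FI f (\<xi>, v) = 0"
        using elim by (intro L2_range_projection_trivial[OF Phat_projection])
          (auto simp: space Omega_def fiber_dim_def)
    qed
  qed
  have "L2_eq ?M (toeplitz P \<phi> f)
      (Lambda_op ?M H (restrict_space \<nu>' ?\<Omega>) (R_op lam FI q) (gamma_fun lam q \<psi>) f)"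
    if f: "f \<in> H" for f
    \<comment> \<open>The claim becomes that the adjoint of R, applied to \<gamma> R f, is the
      Toeplitz value; it is tested against an arbitrary k in \<open>H\<close>.\<close>
    unfolding Lambda_op_def
  proof (rule toeplitz_eq_L2_adjoint[OF H_closed P_projection])
    show \<phi>f: "(\<lambda>z. \<phi> z * f z) \<in> L2 ?M"
      using \<phi> H_L2[OF f] by (rule L2_mult_Linf)
    fix k assume k: "k \<in> H"
    have "L2_inner ?M k (\<lambda>z. \<phi> z * f z) = L2_inner ?N (FI k) (FI (\<lambda>z. \<phi> z * f z))"
      by (rule FI_inner[OF H_L2[OF k] \<phi>f, symmetric])
    also have "\<dots> = L2_inner ?N (FI k) (\<lambda>z. \<psi> (snd z) * FI f z)"
      using tensor_id_mult_snd[OF nu Y_sigma_finite F fourier_tensor psi H_L2[OF f]]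
      by (intro L2_inner_cong_AE FI_L2 H_L2 \<phi>f k L2_mult_Linf[OF lam.Linf_snd[OF psi]] f)
        (auto simp: \<phi>_eq)
    also have "\<dots> = L2_inner (restrict_space \<nu>' ?\<Omega>) (R_op lam FI q k)
        (\<lambda>\<xi>. gamma_fun lam q \<psi> \<xi> * R_op lam FI q f \<xi>)"
      by (intro L2_inner_line_fibres[OF Y_sigma_finite \<Omega> q_L2 q_norm q_measurable psi]
          FI_L2 H_L2 line zero k f)
    finally show "L2_inner ?M k (\<lambda>z. \<phi> z * f z) = L2_inner (restrict_space \<nu>' ?\<Omega>)
        (R_op lam FI q k) (\<lambda>\<xi>. gamma_fun lam q \<psi> \<xi> * R_op lam FI q f \<xi>)" .
  qed
  then show ?thesis
    using \<phi> commutant gamma by blast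
qed

end
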